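(* Let $F(z)=\sum_{k=0}^{n}A_kz^{n-k}\in\mathbb C[z]^{p\times p}$ be monic ($A_0=I_p$) of degree $n\ge2$, with even part $F_e$ and odd part $F_o$. Let $(\mathbf s_k)_{k\ge0}$ be the sequence of right Markov parameters of $F$ if $n=2m$, or of right Markov parameters of second type if $n=2m+1$, and assume $\mathbf s_0,\dots,\mathbf s_{n-1}$ are Hermitian. For matrices $\mathbf c_1,\dots,\mathbf c_n\in\mathbb C^{p\times p}$ and a choice of which indices carry a factor $z$, define rational matrix functions $R_{n-1}(z)=z\mathbf c_{n-1}+\mathbf c_n^{-1}$ and $R_j(z)=d_j(z)+R_{j+1}(z)^{-1}$ for $j=n-2,\dots,1$. (i) If $n=2m$, take $d_j(z)=z\mathbf c_j$ for odd $j$ and $d_j(z)=\mathbf c_j$ for even $j$. Then $F$ is a Hurwitz matrix polynomial if and only if there exist positive definite $\mathbf c_1,\dots,\mathbf c_n\in\mathbb C^{p\times p}$ such that $F_o(z)F_e(z)^{-1}=R_1(z)^{-1}$ for all large enough $z\in\mathbb C$. (ii) If $n=2m+1$, take $d_j(z)=\mathbf c_j$ for odd $j$ and $d_j(z)=z\mathbf c_j$ for even $j$. Then the following are equivalent: (a) $F$ is a Hurwitz matrix polynomial; (b) there exist positive definite $\mathbf c_1,\dots,\mathbf c_n$ such that $F_e(z)F_o(z)^{-1}=R_1(z)^{-1}$ for all large enough $z$; (c) $F_e$ is regular and there exist positive definite $\mathbf c_1,\dots,\mathbf c_n$ such that $F_o(z)F_e(z)^{-1}=R_1(z)$ for all large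 enough $z$.
   Context: Even/odd parts: if $n=2m$, $F_e(z)=\sum_{k=0}^mA_{2k}z^{m-k}$, $F_o(z)=\sum_{k=1}^mA_{2k-1}z^{m-k}$; if $n=2m+1$, $F_e(z)=\sum_{k=0}^mA_{2k+1}z^{m-k}$, $F_o(z)=\sum_{k=0}^mA_{2k}z^{m-k}$. Right Markov parameters ($n=2m$): $F_o(z)F_e(z)^{-1}=\sum_{k\ge0}(-1)^kz^{-(k+1)}\mathbf s_k$ for large $|z|$; right Markov parameters of second type ($n=2m+1$): $F_e(z)F_o(z)^{-1}=\sum_{k\ge0}(-1)^kz^{-k}\mathbf s_k$ for large $|z|$. Thus the continued fractions read, e.g. in case (i), $F_oF_e^{-1}=\big(z\mathbf c_1+(\mathbf c_2+(z\mathbf c_3+\cdots+(z\mathbf c_{n-1}+\mathbf c_n^{-1})^{-1}\cdots)^{-1})^{-1}\big)^{-1}$. A Hurwitz matrix polynomial is one all of whose roots of $\det F(z)$ lie in $\operatorname{Re}z<0$; $F_e$ regular means $\det F_e\not\equiv0$. *)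

theory Defs
  imports "HOL-Analysis.Analysis"
begin

type_synonym 'p cmat = "complex^'p^'p"

definition cscale :: "complex \<Rightarrow> 'p::finite cmat \<Rightarrow> 'p cmat" where
  "cscale a M = (\<chi> i j. a * M$i$j)"

definition hermitian :: "'p::finite cmat \<Rightarrow> bool" where
  "hermitian M \<longleftrightarrow> (\<forall>i j. M$i$j = cnj (M$j$i))"

definition posdef :: "'p::finite cmat \<Rightarrow> bool" where
  "posdef M \<longleftrightarrow> hermitian M \<and>
     (\<forall>x::complex^'p. x \<noteq> 0 \<longrightarrow> Re (\<Sum>i\<in>UNIV. \<Sum>j\<in>UNIV. cnj (x$i) * M$i$j * x$j) > 0)"

definition mpoly :: "(nat \<Rightarrow> 'p::finite cmat) \<Rightarrow> nat \<Rightarrow> complex \<Rightarrow> 'p cmat" where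
  "mpoly A n z = (\<Sum>k=0..n. cscale (z ^ (n - k)) (A k))"

definition Feven :: "(nat \<Rightarrow> 'p::finite cmat) \<Rightarrow> nat \<Rightarrow> complex \<Rightarrow> 'p cmat" where
  "Feven A n z = (let m = n div 2 in
     if even n then (\<Sum>k=0..m. cscale (z ^ (m - k)) (A (2*k)))
     else (\<Sum>k=0..m. cscale (z ^ (m - k)) (A (2*k+1))))"

definition Fodd :: "(nat \<Rightarrow> 'p::finite cmat) \<Rightarrow> nat \<Rightarrow> complex \<Rightarrow> 'p cmat" where
  "Fodd A n z = (let m = n div 2 in
     if even n then (\<Sum>k=1..m. cscale (z ^ (m - k)) (A (2*k-1)))
     else (\<Sum>k=0..m. cscale (z ^ (m - k)) (A (2*k))))"

definition hurwitz :: "(nat \<Rightarrow> 'p::finite cmat) \<Rightarrow> nat \<Rightarrow> bool" where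
  "hurwitz A n \<longleftrightarrow> (\<forall>z. det (mpoly A n z) = 0 \<longrightarrow> Re z < 0)"

definition markov_params :: "(nat \<Rightarrow> 'p::finite cmat) \<Rightarrow> nat \<Rightarrow> (nat \<Rightarrow> 'p cmat) \<Rightarrow> bool" where
  "markov_params A n s \<longleftrightarrow> (\<exists>r. \<forall>z. norm z > r \<longrightarrow>
     (if even n then
        (\<lambda>k. cscale ((-1)^k / z^(k+1)) (s k)) sums (Fodd A n z ** matrix_inv (Feven A n z))
      else
        (\<lambda>k. cscale ((-1)^k / z^k) (s k)) sums (Feven A n z ** matrix_inv (Fodd A n z))))"

function cfR :: "nat \<Rightarrow> (nat \<Rightarrow> bool) \<Rightarrow> (nat \<Rightarrow> 'p::finite cmat) \<Rightarrow> nat \<Rightarrow> complex \<Rightarrow> 'p cmat" where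
  "cfR n zf c j z =
     (if n \<le> j + 1 then cscale z (c (n-1)) + matrix_inv (c n)
      else (if zf j then cscale z (c j) else c j) + matrix_inv (cfR n zf c (j+1) z))"
  by auto
termination by (relation "Wellfounded.measure (\<lambda>(n,zf,c,j,z). n - j)") auto

end

(*
Put z = \<zeta>^2. In the variable \<zeta> both parities of n look alike: F = G_0 + G_1, where G_0 collects the
A_k with k even and G_1 those with k odd, and the continued fraction says that G_0 = S_1 G_1 with
S_j = \<zeta> c_j + S_{j+1}^{-1} and S_n = \<zeta> c_n. Equivalently, the Euclidean algorithm
G_{j-1} = \<zeta> c_j G_j + G_{j+1} runs from (G_0, G_1) down to G_{n+1} = 0.

If the algorithm runs with positive definite c_j and F(\<zeta>) v = 0, put y_j = G_j(\<zeta>) v. Summing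
<y_j, y_{j-1}> = \<zeta> <y_j, c_j y_j> + <y_j, y_{j+1}> gives Re \<zeta> * sum_j <y_j, c_j y_j> = - |y_1|^2,
which forces Re \<zeta> < 0 because G_n is a constant invertible matrix (by Liouville's theorem).

Conversely, Hermitian Markov parameters make G_1(\<eta>)^* G_0(\<zeta>) + G_0(\<eta>)^* G_1(\<zeta>) divisible by
\<zeta> + cnj \<eta>; the coefficients B_{kl} of the quotient (the Bezoutian) define a Hermitian form V on
the solutions of the recurrence F(S) x = 0, S being the shift, with
V(Sx, x) + V(x, Sx) = - 2 |G_1(S) x|^2. If F is Hurwitz, V is positive definite: an invariant
subspace on which it is so can be enlarged by one vector at a time, following a factorization of
det F, which annihilates all solutions. One step of the Euclidean algorithm replaces B by a Schur
complement, so it keeps producing positive definite c_j.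
*)
theory Submission
  imports Defs "HOL-Complex_Analysis.Complex_Analysis" "HOL-Computational_Algebra.Fundamental_Theorem_Algebra"
begin

text \<open>Positive definiteness of V is proved on solutions but used for the block matrix B. The
  two agree because F is monic: the first n terms of a solution are arbitrary and determine the
  others. Solutions supply the shift-invariant subspaces that a Lyapunov argument needs; the block
  matrix is what the Schur complements act on.

  The Lyapunov identity alone gives only weak inequalities. Strictness comes from coprimality of G_0
  and G_1, which follows from the Hurwitz property because both have a definite parity.

  In the other implication the continued fraction is known only near infinity, so nothing says
  beforehand that the Euclidean algorithm with the given c_j stops. Its remainders are polynomials,
  and growth at infinity decides: each S_j grows exactly like \<zeta>, so the remainder of index n
  is bounded, and the next one vanishes near infinity.

  Finitely many Hermitian s_k suffice because those coefficients of the symmetry relation that would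
  involve later ones vanish on both sides for reasons of degree.\<close>

no_notation fps_nth (infixl "$" 75)
declare cfR.simps [simp del]

section \<open>Complex matrices\<close>

definition cinner :: "complex^'p::finite \<Rightarrow> complex^'p \<Rightarrow> complex" where
  "cinner x y = (\<Sum>i\<in>UNIV. cnj (x$i) * y$i)"

definition cadj :: "'p::finite cmat \<Rightarrow> 'p cmat" where
  "cadj M = (\<chi> i j. cnj (M$j$i))"

lemma cinner_simps:
  "cinner (x + y) z = cinner x z + cinner y z"
  "cinner x (y + z) = cinner x y + cinner x z"
  "cinner (x - y) z = cinner x z - cinner y z"
  "cinner x (y - z) = cinner x y - cinner x z"
  "cinner (- x) y = - cinner x y"
  "cinner x (- y) = - cinner x y"
  "cinner (a *s x) y = cnj a * cinner x y"
  "cinner x (a *s y) = a * cinner x y"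
  "cinner 0 y = 0" "cinner x 0 = 0"
  by (simp_all add: cinner_def algebra_simps sum.distrib sum_subtractf sum_negf sum_distrib_left)

lemma cinner_sum_left: "cinner (\<Sum>k\<in>I. f k) y = (\<Sum>k\<in>I. cinner (f k) y)"
  by (induction I rule: infinite_finite_induct) (auto simp: cinner_simps)

lemma cinner_sum_right: "cinner x (\<Sum>k\<in>I. f k) = (\<Sum>k\<in>I. cinner x (f k))"
  by (induction I rule: infinite_finite_induct) (auto simp: cinner_simps)

lemma cnj_cinner: "cnj (cinner x y) = cinner y x"
  by (simp add: cinner_def mult.commute)

lemma cinner_self: "cinner x x = of_real (\<Sum>i\<in>UNIV. (cmod (x$i))\<^sup>2)"
  by (simp add: cinner_def complex_norm_square[symmetric] mult.commute flip: of_real_power)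

lemma cinner_self_nonneg: "Re (cinner x x) \<ge> 0"
  by (simp add: cinner_self sum_nonneg)

lemma cinner_self_eq_0 [simp]: "cinner x x = 0 \<longleftrightarrow> x = 0"
proof -
  have "cinner x x = 0 \<longleftrightarrow> (\<forall>i. (cmod (x$i))\<^sup>2 = 0)"
    unfolding cinner_self of_real_eq_0_iff by (subst sum_nonneg_eq_0_iff) auto
  then show ?thesis by (simp add: vec_eq_iff)
qed

lemma Im_cinner_self [simp]: "Im (cinner x x) = 0"
  by (simp add: cinner_self)

lemma Re_cinner_self_pos: "x \<noteq> 0 \<Longrightarrow> Re (cinner x x) > 0"
  using cinner_self_nonneg[of x] cinner_self_eq_0[of x] by (auto simp: complex_eq_iff order_less_le)

lemma cinner_cadj: "cinner (M *v x) y = cinner x (cadj M *v y)"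
  unfolding cinner_def cadj_def matrix_vector_mult_def
  by (simp add: sum_distrib_left sum_distrib_right mult_ac) (rule sum.swap)

lemma cadj_simps [simp]:
  "cadj (cadj M) = M" "cadj 0 = 0" "cadj (M + N) = cadj M + cadj N"
  "cadj (M - N) = cadj M - cadj N" "cadj (- M) = - cadj M" "cadj (mat 1) = mat 1"
  by (auto simp: cadj_def vec_eq_iff mat_def)

lemma cadj_mult: "cadj (M ** N) = cadj N ** cadj M"
  by (auto simp: cadj_def vec_eq_iff matrix_matrix_mult_def mult.commute)

lemma cadj_sum: "cadj (\<Sum>k\<in>I. f k) = (\<Sum>k\<in>I. cadj (f k))"
  by (induction I rule: infinite_finite_induct) auto

lemma hermitian_iff_cadj: "hermitian M \<longleftrightarrow> cadj M = M"
  unfolding hermitian_def cadj_def vec_eq_iff by simp metis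

lemma posdef_iff: "posdef M \<longleftrightarrow> cadj M = M \<and> (\<forall>x. x \<noteq> 0 \<longrightarrow> Re (cinner x (M *v x)) > 0)"
  unfolding posdef_def hermitian_iff_cadj cinner_def matrix_vector_mult_def
  by (simp add: sum_distrib_left mult.assoc)

lemma cscale_nth [simp]: "cscale a M $ i $ j = a * M $ i $ j"
  by (simp add: cscale_def)

lemma cscale_simps [simp]:
  "cscale 1 M = M" "cscale 0 M = 0" "cscale a 0 = 0" "cscale a (cscale b M) = cscale (a * b) M"
  "cscale a (- M) = - cscale a M"
  by (auto simp: vec_eq_iff mult.assoc)

lemma cscale_add: "cscale a (M + N) = cscale a M + cscale a N"
  by (auto simp: vec_eq_iff algebra_simps)

lemma cscale_diff: "cscale a (M - N) = cscale a M - cscale a N"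
  by (auto simp: vec_eq_iff algebra_simps)

lemma cscale_mult_left: "cscale a M ** N = cscale a (M ** N)"
  by (auto simp: vec_eq_iff matrix_matrix_mult_def sum_distrib_left mult_ac)

lemma cscale_mult_right: "M ** cscale a N = cscale a (M ** N)"
  by (auto simp: vec_eq_iff matrix_matrix_mult_def sum_distrib_left mult_ac)

lemma cscale_mult_vec: "cscale a M *v x = a *s (M *v x)"
  by (auto simp: vec_eq_iff matrix_vector_mult_def sum_distrib_left mult_ac)

lemma cscale_sum: "cscale a (\<Sum>k\<in>I. f k) = (\<Sum>k\<in>I. cscale a (f k))"
  by (induction I rule: infinite_finite_induct) (auto simp: cscale_add)

lemma cscale_minus_left: "cscale (- a) M = - cscale a M"
  by (simp add: vec_eq_iff)

lemma cadj_cscale: "cadj (cscale a M) = cscale (cnj a) (cadj M)"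
  by (simp add: cadj_def vec_eq_iff)

lemma matrix_add_rdistrib: "(M + N) ** K = M ** K + N ** K" for M N K :: "'p::finite cmat"
  by (simp add: vec_eq_iff matrix_matrix_mult_def algebra_simps sum.distrib)

lemma matrix_mult_sum_left: "(\<Sum>k\<in>I. f k) ** (M :: 'a::semiring_1^'n^'n) = (\<Sum>k\<in>I. f k ** M)"
  by (induction I rule: infinite_finite_induct) (auto simp: vec_eq_iff matrix_matrix_mult_def algebra_simps sum.distrib)

lemma matrix_mult_sum_right: "(M :: 'a::semiring_1^'n^'n) ** (\<Sum>k\<in>I. f k) = (\<Sum>k\<in>I. M ** f k)"
  by (induction I rule: infinite_finite_induct) (auto simp: vec_eq_iff matrix_matrix_mult_def algebra_simps sum.distrib)

lemma matrix_mult_diff: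
  fixes M N K :: "'p::finite cmat"
  shows "M ** (N - K) = M ** N - M ** K" "(M - N) ** K = M ** K - N ** K"
  by (auto simp: vec_eq_iff matrix_matrix_mult_def algebra_simps sum_subtractf)

lemma sum_matrix_vector: "(\<Sum>k\<in>I. f k) *v (x::complex^'p) = (\<Sum>k\<in>I. f k *v x)"
  for f :: "'i \<Rightarrow> 'p::finite cmat"
  by (induction I rule: infinite_finite_induct) (auto simp: matrix_vector_mult_add_rdistrib)

lemma matrix_vector_sum: "M *v (\<Sum>k\<in>I. f k) = (\<Sum>k\<in>I. M *v f k)"
  for M :: "'p::finite cmat"
  by (induction I rule: infinite_finite_induct) (auto simp: matrix_vector_right_distrib)

lemma matrix_inv_left: "invertible M \<Longrightarrow> matrix_inv M ** M = mat 1"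
  and matrix_inv_right: "invertible M \<Longrightarrow> M ** matrix_inv M = mat 1"
  for M :: "'p::finite cmat"
  unfolding invertible_def matrix_inv_def by (metis (mono_tags, lifting) someI_ex)+

lemma matrix_inv_eqI:
  fixes M N :: "'p::finite cmat"
  assumes "M ** N = mat 1" shows "matrix_inv M = N" "invertible M"
proof -
  show i: "invertible M" using assms matrix_left_right_inverse unfolding invertible_def by blast
  have "matrix_inv M = matrix_inv M ** (M ** N)" using assms by simp
  also have "\<dots> = N" using matrix_inv_left[OF i] by (simp add: matrix_mul_assoc)
  finally show "matrix_inv M = N" .
qed

lemma invertible_mat_1: "invertible (mat 1 :: 'p::finite cmat)"
  by (rule matrix_inv_eqI(2)[of _ "mat 1"]) simp

lemma invertible_iff_ker:
  fixes M :: "'p::finite cmat"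
  shows "invertible M \<longleftrightarrow> (\<forall>x. M *v x = 0 \<longrightarrow> x = 0)"
  using invertible_left_inverse[of M] matrix_left_invertible_ker[of M] by blast

lemma det_eq_0_iff_ker:
  fixes M :: "'p::finite cmat"
  shows "det M = 0 \<longleftrightarrow> (\<exists>x. x \<noteq> 0 \<and> M *v x = 0)"
  using invertible_iff_ker[of M] invertible_det_nz[of M] by blast

lemma posdef_invertible: "posdef M \<Longrightarrow> invertible M"
  unfolding posdef_iff invertible_iff_ker by (metis cinner_simps(10) less_irrefl zero_complex.simps(1))

lemma invertible_cscale: "a \<noteq> 0 \<Longrightarrow> invertible M \<Longrightarrow> invertible (cscale a M)"
  by (rule matrix_inv_eqI(2)[where N = "cscale (1/a) (matrix_inv M)"])
    (simp add: cscale_mult_left cscale_mult_right matrix_inv_right)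

lemma matrix_inv_cscale:
  "a \<noteq> 0 \<Longrightarrow> invertible M \<Longrightarrow> matrix_inv (cscale a M) = cscale (1/a) (matrix_inv M)"
  by (rule matrix_inv_eqI(1)) (simp add: cscale_mult_left cscale_mult_right matrix_inv_right)

text \<open>The adjugate. It is set up over a commutative ring because it serves twice: over the
  complex numbers for the continuity of inversion, and over polynomials to show that the determinant
  annihilates solutions of a recurrence.\<close>

definition cofactor_matrix :: "'a::comm_ring_1^'p^'p \<Rightarrow> 'a^'p::finite^'p" where
  "cofactor_matrix M = (\<chi> i j. det (\<chi> k. if k = j then axis i 1 else M$k))"

lemma sum_axis: "(\<Sum>i\<in>UNIV. v$i *s axis i 1) = (v :: 'a::comm_ring_1^'p::finite)"
  by (simp add: vec_eq_iff axis_def if_distrib cong: if_cong)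

lemma cofactor_matrix_right:
  fixes M :: "'a::comm_ring_1^'p^'p::finite"
  shows "M ** cofactor_matrix M = (\<chi> i j. if i = j then det M else 0)"
proof -
  have "(\<Sum>k\<in>UNIV. M$i$k * det (\<chi> l. if l = j then axis k 1 else M$l)) = (if i = j then det M else 0)" for i j
  proof -
    have "(\<Sum>k\<in>UNIV. M$i$k * det (\<chi> l. if l = j then axis k 1 else M$l))
        = (\<Sum>k\<in>UNIV. det (\<chi> l. if l = j then M$i$k *s axis k 1 else M$l))"
      by (simp add: det_row_mul)
    also have "\<dots> = det (\<chi> l. if l = j then (\<Sum>k\<in>UNIV. M$i$k *s axis k 1) else M$l)"
      by (subst det_linear_row_sum) auto
    also have "\<dots> = det (\<chi> l. if l = j then M$i else M$l)"
      by (simp only: sum_axis)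
    also have "\<dots> = (if i = j then det M else 0)"
    proof (cases "i = j")
      case True
      then have "(\<chi> l. if l = j then M$i else M$l) = M" by (simp add: vec_eq_iff)
      then show ?thesis using True by simp
    next
      case False
      then show ?thesis
        by (simp, intro det_identical_rows[of i j]) (auto simp: row_def vec_eq_iff)
    qed
    finally show ?thesis .
  qed
  then show ?thesis by (simp add: vec_eq_iff matrix_matrix_mult_def cofactor_matrix_def)
qed

lemma matrix_inv_cofactor:
  fixes M :: "'p::finite cmat"
  assumes "det M \<noteq> 0"
  shows "matrix_inv M = cscale (1 / det M) (cofactor_matrix M)"
  by (rule matrix_inv_eqI(1)) (use assms in \<open>simp add: cscale_mult_right cofactor_matrix_right vec_eq_iff mat_def\<close>)

section \<open>Continuity of determinant and inversion\<close>

lemma tendsto_det: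
  fixes f :: "'b \<Rightarrow> 'p::finite cmat"
  assumes "(f \<longlongrightarrow> L) F"
  shows "((\<lambda>x. det (f x)) \<longlongrightarrow> det L) F"
  unfolding det_def by (intro tendsto_intros assms)

lemma tendsto_matrix_mult:
  fixes f g :: "'b \<Rightarrow> 'p::finite cmat"
  assumes "(f \<longlongrightarrow> L) F" "(g \<longlongrightarrow> M) F"
  shows "((\<lambda>x. f x ** g x) \<longlongrightarrow> L ** M) F"
  unfolding matrix_matrix_mult_def by (intro tendsto_intros assms)

lemma tendsto_cscale:
  fixes g :: "'b \<Rightarrow> 'p::finite cmat"
  assumes "(a \<longlongrightarrow> b) F" "(g \<longlongrightarrow> M) F"
  shows "((\<lambda>x. cscale (a x) (g x)) \<longlongrightarrow> cscale b M) F"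
  unfolding cscale_def by (intro tendsto_intros assms)

text \<open>By Cramer's rule the entries of the inverse are rational in the entries of the matrix,
  with the determinant as denominator.\<close>

lemma tendsto_matrix_inv:
  fixes f :: "'b \<Rightarrow> 'p::finite cmat"
  assumes "(f \<longlongrightarrow> L) F" "invertible L"
  shows "((\<lambda>x. matrix_inv (f x)) \<longlongrightarrow> matrix_inv L) F"
    and "eventually (\<lambda>x. invertible (f x)) F"
proof -
  have d: "det L \<noteq> 0" using assms(2) invertible_det_nz by blast
  have ev: "eventually (\<lambda>x. det (f x) \<noteq> 0) F"
    using tendsto_imp_eventually_ne[OF tendsto_det[OF assms(1)] d] .
  then show "eventually (\<lambda>x. invertible (f x)) F" by (simp add: invertible_det_nz)
  have "((\<lambda>x. cofactor_matrix (f x)) \<longlongrightarrow> cofactor_matrix L) F"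
    unfolding cofactor_matrix_def
  proof (intro tendsto_vec_lambda tendsto_det)
    fix i j k
    show "((\<lambda>x. if k = j then axis i 1 else f x $ k) \<longlongrightarrow> (if k = j then axis i 1 else L $ k)) F"
      by (cases "k = j") (auto intro!: tendsto_intros assms)
  qed
  then have "((\<lambda>x. cscale (1 / det (f x)) (cofactor_matrix (f x))) \<longlongrightarrow> cscale (1 / det L) (cofactor_matrix L)) F"
    by (intro tendsto_cscale tendsto_intros tendsto_det assms d)
  then show "((\<lambda>x. matrix_inv (f x)) \<longlongrightarrow> matrix_inv L) F"
    unfolding matrix_inv_cofactor[OF d]
    by (rule Lim_transform_eventually) (use ev in eventually_elim, simp add: matrix_inv_cofactor)
qed

section \<open>A Lyapunov form on the solutions of a linear recurrence\<close>

text \<open>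
  The assumption \<open>B_rec\<close> compares coefficients in
  \<open>(\<zeta> + cnj \<eta>) B(\<zeta>, \<eta>) = G\<^sub>1(\<eta>)\<^sup>* G\<^sub>0(\<zeta>) + G\<^sub>0(\<eta>)\<^sup>* G\<^sub>1(\<zeta>)\<close>.
\<close>

locale stable_pencil =
  fixes n :: nat and P Q :: "nat \<Rightarrow> 'p::finite cmat" and B :: "nat \<Rightarrow> nat \<Rightarrow> 'p cmat"
  assumes n_pos: "n > 0"
    and P_lead: "P n = mat 1"
    and Q_high: "\<And>k. k \<ge> n \<Longrightarrow> Q k = 0"
    and B_high: "\<And>k l. k \<ge> n \<or> l \<ge> n \<Longrightarrow> B k l = 0"
    and B_herm: "\<And>k l. cadj (B k l) = B l k"
    and B_rec: "\<And>k l. (if k = 0 then 0 else B (k-1) l) + (if l = 0 then 0 else B k (l-1))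
                  = cadj (Q k) ** P l + cadj (P k) ** Q l"
    and stable: "\<And>\<zeta> v. v \<noteq> 0 \<Longrightarrow> (\<Sum>l\<le>n. \<zeta>^l *s ((P l + Q l) *v v)) = 0 \<Longrightarrow> Re \<zeta> < 0"
    and coprime: "\<And>\<zeta> v. (\<Sum>l\<le>n. \<zeta>^l *s (P l *v v)) = 0 \<Longrightarrow> (\<Sum>l\<le>n. \<zeta>^l *s (Q l *v v)) = 0 \<Longrightarrow> v = 0"
begin

definition V :: "(nat \<Rightarrow> complex^'p) \<Rightarrow> (nat \<Rightarrow> complex^'p) \<Rightarrow> complex" where
  "V x y = (\<Sum>k<n. \<Sum>l<n. cinner (x k) (B k l *v y l))"

text \<open>The value of \<open>G\<^sub>1(S) x\<close> at index 0, where \<open>S\<close> is the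
  shift; \<open>X\<close> below is the kernel of \<open>G\<^sub>0(S) + G\<^sub>1(S)\<close>.\<close>

definition L :: "(nat \<Rightarrow> complex^'p) \<Rightarrow> complex^'p" where
  "L x = (\<Sum>l\<le>n. Q l *v x l)"

definition X :: "(nat \<Rightarrow> complex^'p) set" where
  "X = {x. \<forall>k. (\<Sum>l\<le>n. (P l + Q l) *v x (k + l)) = 0}"

definition sh :: "(nat \<Rightarrow> complex^'p) \<Rightarrow> nat \<Rightarrow> complex^'p" where
  "sh x = (\<lambda>k. x (Suc k))"

text \<open>Merging scaling and addition makes linearity and closure of a subspace one condition
  each.\<close>

definition axpy :: "complex \<Rightarrow> (nat \<Rightarrow> complex^'p) \<Rightarrow> (nat \<Rightarrow> complex^'p) \<Rightarrow> nat \<Rightarrow> complex^'p" where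
  "axpy a x y = (\<lambda>k. a *s x k + y k)"

lemma V_axpy_left: "V (axpy a x y) z = cnj a * V x z + V y z"
  by (simp add: V_def axpy_def cinner_simps sum.distrib sum_distrib_left)

lemma V_axpy_right: "V z (axpy a x y) = a * V z x + V z y"
  by (simp add: V_def axpy_def cinner_simps sum.distrib sum_distrib_left
      matrix_vector_right_distrib vec.scale)

lemma V_zero: "V (\<lambda>k. 0) y = 0" "V x (\<lambda>k. 0) = 0"
  by (simp_all add: V_def cinner_simps)

lemma cnj_V: "cnj (V x y) = V y x"
proof -
  have "cnj (V x y) = (\<Sum>k<n. \<Sum>l<n. cinner (B k l *v y l) (x k))"
    by (simp add: V_def cnj_cinner)
  also have "\<dots> = (\<Sum>k<n. \<Sum>l<n. cinner (y l) (B l k *v x k))"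
    by (simp add: cinner_cadj B_herm)
  also have "\<dots> = V y x"
    unfolding V_def by (rule sum.swap)
  finally show ?thesis .
qed

lemma V_self_real: "V x x = of_real (Re (V x x))"
  using cnj_V[of x x] by (metis Reals_cnj_iff of_real_Re)

lemma X_axpy: "x \<in> X \<Longrightarrow> y \<in> X \<Longrightarrow> axpy a x y \<in> X"
  by (simp add: X_def axpy_def matrix_vector_right_distrib vec.scale sum.distrib
      flip: vec.scale_sum_right)

lemma X_zero: "(\<lambda>k. 0) \<in> X"
  by (simp add: X_def)

lemma X_sh: "x \<in> X \<Longrightarrow> sh x \<in> X"
  unfolding X_def sh_def by (auto dest: spec[where x = "Suc k" for k])

lemma X_PL: assumes "x \<in> X" shows "(\<Sum>l\<le>n. P l *v x l) = - L x"
proof -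
  have "(\<Sum>l\<le>n. (P l + Q l) *v x (0 + l)) = 0" using assms unfolding X_def by blast
  then have "(\<Sum>l\<le>n. P l *v x l) + L x = 0"
    by (simp add: L_def sum.distrib matrix_vector_mult_add_rdistrib)
  then show ?thesis by (simp add: eq_neg_iff_add_eq_0)
qed

text \<open>Reindexing moves the shift from the sequences to \<open>B\<close>; the extra terms at
  index \<open>n\<close> vanish because \<open>B\<close> does. By \<open>B_rec\<close> the form then
  splits into products of \<open>L\<close> with the same sum for \<open>P\<close>, and on solutions
  that sum is \<open>- L\<close> (\<open>X_PL\<close>).\<close>

lemma lyapunov_identity:
  assumes "x \<in> X" "y \<in> X"
  shows "V (sh x) y + V x (sh y) = - 2 * cinner (L x) (L y)"
proof -
  have V1: "V (sh x) y = (\<Sum>k\<le>n. \<Sum>l\<le>n. cinner (x k) ((if k = 0 then 0 else B (k-1) l) *v y l))"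
    (is "_ = (\<Sum>k\<le>n. ?g k)")
  proof -
    have shift: "(\<Sum>k\<le>n. ?g k) = ?g 0 + (\<Sum>k<n. ?g (Suc k))" by (rule sum.atMost_shift)
    have g0: "?g 0 = 0" by (simp add: cinner_simps)
    have gS: "?g (Suc k) = (\<Sum>l<n. cinner (x (Suc k)) (B k l *v y l))" for k
      by (simp add: lessThan_Suc_atMost[symmetric] B_high cinner_simps)
    show ?thesis unfolding shift g0 gS by (simp add: V_def sh_def)
  qed
  have V2: "V x (sh y) = (\<Sum>k\<le>n. \<Sum>l\<le>n. cinner (x k) ((if l = 0 then 0 else B k (l-1)) *v y l))"
    (is "_ = (\<Sum>k\<le>n. \<Sum>l\<le>n. ?g k l)")
  proof -
    have "(\<Sum>l\<le>n. ?g k l) = (\<Sum>l<n. cinner (x k) (B k l *v y (Suc l)))" for k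
    proof -
      have "(\<Sum>l\<le>n. ?g k l) = ?g k 0 + (\<Sum>l<n. ?g k (Suc l))" by (rule sum.atMost_shift)
      then show ?thesis by (simp add: cinner_simps)
    qed
    then show ?thesis
      by (simp add: V_def sh_def lessThan_Suc_atMost[symmetric] B_high cinner_simps)
  qed
  have "V (sh x) y + V x (sh y) = (\<Sum>k\<le>n. \<Sum>l\<le>n. cinner (x k)
      (((if k = 0 then 0 else B (k-1) l) + (if l = 0 then 0 else B k (l-1))) *v y l))"
    unfolding V1 V2 by (simp only: sum.distrib cinner_simps matrix_vector_mult_add_rdistrib)
  also have "\<dots> = (\<Sum>k\<le>n. \<Sum>l\<le>n. cinner (Q k *v x k) (P l *v y l))
                 + (\<Sum>k\<le>n. \<Sum>l\<le>n. cinner (P k *v x k) (Q l *v y l))"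
    unfolding B_rec
    by (simp only: sum.distrib cinner_simps matrix_vector_mult_add_rdistrib cinner_cadj matrix_vector_mul_assoc)
  also have "\<dots> = cinner (L x) (\<Sum>l\<le>n. P l *v y l) + cinner (\<Sum>l\<le>n. P l *v x l) (L y)"
    by (simp only: L_def cinner_sum_left) (simp only: cinner_sum_right)
  also have "\<dots> = - 2 * cinner (L x) (L y)"
    using assms by (simp add: X_PL cinner_simps)
  finally show ?thesis .
qed

text \<open>
  Carrying the existence of \<open>V\<close>-orthogonal projections along as part of the invariant avoids any
  appeal to finite dimension.
\<close>

definition good :: "(nat \<Rightarrow> complex^'p) set \<Rightarrow> bool" where
  "good U \<longleftrightarrow> U \<subseteq> X \<and> (\<lambda>k. 0) \<in> U \<and> (\<forall>x\<in>U. \<forall>y\<in>U. \<forall>a. axpy a x y \<in> U) \<and> (\<forall>x\<in>U. sh x \<in> U)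
     \<and> (\<forall>x\<in>U. x \<noteq> (\<lambda>k. 0) \<longrightarrow> Re (V x x) > 0)
     \<and> (\<forall>x\<in>X. \<exists>u\<in>U. \<forall>w\<in>U. V w (axpy (-1) u x) = 0)"

lemma goodD:
  assumes "good U"
  shows "U \<subseteq> X" "(\<lambda>k. 0) \<in> U" "\<And>x y a. x \<in> U \<Longrightarrow> y \<in> U \<Longrightarrow> axpy a x y \<in> U" "\<And>x. x \<in> U \<Longrightarrow> sh x \<in> U"
    "\<And>x. x \<in> U \<Longrightarrow> x \<noteq> (\<lambda>k. 0) \<Longrightarrow> Re (V x x) > 0"
    "\<And>x. x \<in> X \<Longrightarrow> \<exists>u\<in>U. \<forall>w\<in>U. V w (axpy (-1) u x) = 0"
  using assms unfolding good_def by blast+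

lemma good_zero: "good {\<lambda>k. 0}"
  unfolding good_def by (auto simp: X_zero axpy_def sh_def V_zero)

text \<open>An eigenvector of the shift is geometric, so the recurrence together with
  \<open>L w = 0\<close> makes \<open>w 0\<close> a common null vector of
  \<open>G\<^sub>0(\<mu>)\<close> and \<open>G\<^sub>1(\<mu>)\<close>. This is where coprimality
  enters.\<close>

lemma eigen_sequence:
  assumes "w \<in> X" "sh w = (\<lambda>k. \<mu> *s w k)" "L w = 0"
  shows "w = (\<lambda>k. 0)"
proof -
  have wk: "w k = \<mu>^k *s w 0" for k
  proof (induction k)
    case (Suc k)
    have "w (Suc k) = \<mu> *s w k" using assms(2) unfolding sh_def by meson
    then show ?case using Suc by (simp add: vector_smult_assoc)
  qed simp
  have eq: "(\<Sum>l\<le>n. M l *v w l) = (\<Sum>l\<le>n. \<mu>^l *s (M l *v w 0))" for M :: "nat \<Rightarrow> 'p cmat"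
    by (intro sum.cong refl) (subst wk, simp add: vec.scale)
  have "w 0 = 0"
    by (rule coprime[of \<mu>]) (use X_PL[OF assms(1)] assms(3) in \<open>simp_all add: L_def eq\<close>)
  then show ?thesis using wk by (metis vec.scale_zero_right)
qed

text \<open>Since \<open>sh w\<close> is \<open>\<mu> w\<close> up to an element \<open>u\<close> of
  \<open>U\<close>, and \<open>w\<close> is orthogonal to \<open>U\<close>, the Lyapunov identity
  reads \<open>Re \<mu> * V w w = - |L w|^2\<close>. If \<open>L w = 0\<close>, the identity for the
  pair \<open>u\<close>, \<open>w\<close> gives \<open>V u u = 0\<close>; then \<open>u\<close> is
  zero and \<open>w\<close> is a genuine eigenvector, which \<open>eigen_sequence\<close>
  excludes.\<close>

lemma orthogonal_eigenvector_pos: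
  assumes U: "good U" and w: "w \<in> X" "w \<noteq> (\<lambda>k. 0)" and orth: "\<And>u. u \<in> U \<Longrightarrow> V u w = 0"
    and \<mu>: "Re \<mu> < 0" and u0: "axpy (-\<mu>) w (sh w) \<in> U"
  shows "Re (V w w) > 0"
proof -
  define u where "u = axpy (-\<mu>) w (sh w)"
  have u: "u \<in> U" using u0 u_def by simp
  have shw: "sh w = axpy \<mu> w u" by (auto simp: u_def axpy_def)
  have orth': "V w y = 0" if "y \<in> U" for y using orth[OF that] cnj_V[of y w] by simp
  have "cnj \<mu> * V w w + \<mu> * V w w = - 2 * cinner (L w) (L w)"
    using lyapunov_identity[OF w(1) w(1)]
    by (simp add: shw V_axpy_left V_axpy_right orth[OF u] orth'[OF u])
  then have "(cnj \<mu> + \<mu>) * V w w = - 2 * cinner (L w) (L w)" by (simp add: algebra_simps)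
  then have *: "Re \<mu> * Re (V w w) = - Re (cinner (L w) (L w))"
    by (subst (asm) V_self_real) (simp add: complex_eq_iff)
  show ?thesis
  proof (cases "L w = 0")
    case False
    then have "Re \<mu> * Re (V w w) < 0" using * Re_cinner_self_pos by auto
    then show ?thesis using \<mu> by (simp add: mult_less_0_iff)
  next
    case True
    have uX: "u \<in> X" using u goodD(1)[OF U] by blast
    have "V (sh u) w + V u (sh w) = 0"
      using lyapunov_identity[OF uX w(1)] True by (simp add: cinner_simps)
    then have "V u u = 0"
      using orth[OF goodD(4)[OF U u]] by (simp add: shw V_axpy_right orth[OF u])
    then have "u = (\<lambda>k. 0)" using goodD(5)[OF U u] by force
    then have "sh w = (\<lambda>k. \<mu> *s w k)" using shw by (simp add: axpy_def)
    then have False using eigen_sequence[OF w(1) _ True] w(2) by blast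
    then show ?thesis ..
  qed
qed

text \<open>Gram-Schmidt: \<open>b\<close> is replaced by its component \<open>w\<close> orthogonal
  to \<open>U\<close>, and positivity on the larger space is Pythagoras.\<close>

lemma good_extend:
  assumes U: "good U" and b: "b \<in> X" "axpy (-\<mu>) b (sh b) \<in> U" and \<mu>: "Re \<mu> < 0"
  obtains U' where "good U'" "U \<subseteq> U'" "b \<in> U'"
proof -
  obtain u where u: "u \<in> U" "\<And>y. y \<in> U \<Longrightarrow> V y (axpy (-1) u b) = 0"
    using goodD(6)[OF U b(1)] by blast
  define w where "w = axpy (-1) u b"
  have uX: "u \<in> X" using u goodD(1)[OF U] by blast
  have w: "w \<in> X" unfolding w_def by (intro X_axpy uX b)
  have orth: "V y w = 0" "V w y = 0" if "y \<in> U" for y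
    using u(2)[OF that] cnj_V[of y w] by (simp_all add: w_def)
  have bw: "b = axpy 1 w u" by (auto simp: w_def axpy_def)
  show ?thesis
  proof (cases "w = (\<lambda>k. 0)")
    case True
    then have "b = u" using bw by (simp add: axpy_def)
    then show ?thesis using that[OF U] u by blast
  next
    case False
    \<comment> \<open>As \<open>U\<close> is invariant under the shift, subtracting the projection
      \<open>u\<close> keeps \<open>w\<close> an eigenvector modulo \<open>U\<close>.\<close>
    have "axpy (-1) (axpy (-\<mu>) u (sh u)) (axpy (-\<mu>) b (sh b)) \<in> U"
      by (intro goodD(3)[OF U] goodD(4)[OF U] b u)
    also have "axpy (-1) (axpy (-\<mu>) u (sh u)) (axpy (-\<mu>) b (sh b)) = axpy (-\<mu>) w (sh w)"
      by (auto simp: w_def axpy_def sh_def vec_eq_iff algebra_simps)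
    finally have u0: "axpy (-\<mu>) w (sh w) \<in> U" .
    have pos: "Re (V w w) > 0"
      by (rule orthogonal_eigenvector_pos[OF U w False orth(1) \<mu> u0])
    define U' where "U' = {axpy a w y | a y. y \<in> U}"
    have U'I: "axpy a w y \<in> U'" if "y \<in> U" for a y using that U'_def by blast
    have sub: "U \<subseteq> U'"
    proof
      fix y assume "y \<in> U"
      then have "axpy 0 w y \<in> U'" by (rule U'I)
      then show "y \<in> U'" by (simp add: axpy_def)
    qed
    have "good U'"
      unfolding good_def
    proof (intro conjI ballI allI impI)
      show "U' \<subseteq> X" using U'_def X_axpy w goodD(1)[OF U] by blast
      show "(\<lambda>k. 0) \<in> U'" using sub goodD(2)[OF U] by blast
    next
      fix x y a assume "x \<in> U'" "y \<in> U'"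
      then obtain p q s t where 1: "x = axpy p w s" "y = axpy q w t" "s \<in> U" "t \<in> U"
        unfolding U'_def by blast
      have "axpy a x y = axpy (a * p + q) w (axpy a s t)"
        by (auto simp: 1 axpy_def vec_eq_iff algebra_simps)
      then show "axpy a x y \<in> U'" using U'I goodD(3)[OF U] 1 by metis
    next
      fix x assume "x \<in> U'"
      then obtain p s where 1: "x = axpy p w s" "s \<in> U" unfolding U'_def by blast
      have "sh x = axpy (p * \<mu>) w (axpy p (axpy (-\<mu>) w (sh w)) (sh s))"
        by (auto simp: 1 axpy_def sh_def vec_eq_iff algebra_simps)
      then show "sh x \<in> U'" using U'I goodD(3)[OF U u0 goodD(4)[OF U 1(2)]] by metis
    next
      fix x assume "x \<in> U'" and nz: "x \<noteq> (\<lambda>k. 0)"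
      then obtain p s where 1: "x = axpy p w s" "s \<in> U" unfolding U'_def by blast
      have "V x x = cnj p * p * V w w + V s s"
        by (simp add: 1 V_axpy_left V_axpy_right orth[OF 1(2)] algebra_simps)
      then have e: "Re (V x x) = (cmod p)\<^sup>2 * Re (V w w) + Re (V s s)"
        by (subst (asm) (2) V_self_real) (simp add: cmod_power2[unfolded power2_eq_square] power2_eq_square)
      show "Re (V x x) > 0"
      proof (cases "s = (\<lambda>k. 0)")
        case True
        then have "p \<noteq> 0" using nz 1 by (auto simp: axpy_def)
        then show ?thesis using e True pos by (simp add: V_zero)
      next
        case False
        have "(cmod p)\<^sup>2 * Re (V w w) \<ge> 0" using pos by simp
        then show ?thesis using e goodD(5)[OF U 1(2) False] by linarith
      qed
    next
      fix x assume x: "x \<in> X"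
      obtain y where y: "y \<in> U" "\<And>z. z \<in> U \<Longrightarrow> V z (axpy (-1) y x) = 0"
        using goodD(6)[OF U x] by blast
      \<comment> \<open>The coefficient of the orthogonal projection of \<open>x\<close> onto the
        line spanned by \<open>w\<close>; added to the projection \<open>y\<close> onto
        \<open>U\<close> it gives the projection onto \<open>U'\<close>.\<close>
      define a where "a = V w x / V w w"
      have wnz: "V w w \<noteq> 0" using pos by auto
      show "\<exists>u\<in>U'. \<forall>z\<in>U'. V z (axpy (-1) u x) = 0"
      proof (intro bexI ballI)
        show "axpy a w y \<in> U'" by (intro U'I y)
        fix z assume "z \<in> U'"
        then obtain p s where 1: "z = axpy p w s" "s \<in> U" unfolding U'_def by blast
        have "V s x = V s y" using y(2)[OF 1(2)] by (simp add: V_axpy_right)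
        then show "V z (axpy (-1) (axpy a w y) x) = 0"
          using wnz by (simp add: 1 V_axpy_left V_axpy_right orth[OF 1(2)] orth[OF y(1)] a_def field_simps)
      qed
    qed
    moreover have "b \<in> U'" unfolding bw by (intro U'I u)
    ultimately show ?thesis using that sub by blast
  qed
qed

end

section \<open>Extending invariant subspaces along the roots of the determinant\<close>

text \<open>The sequence \<open>q(S) f\<close> for the shift \<open>S\<close>. Polynomials thus act
  on scalar sequences, with product going to composition (\<open>shift_act_mult\<close>).\<close>

definition shift_act :: "complex poly \<Rightarrow> (nat \<Rightarrow> complex) \<Rightarrow> nat \<Rightarrow> complex" where
  "shift_act q f k = (\<Sum>i\<le>degree q. coeff q i * f (k + i))"

lemma shift_act_bound:
  assumes "degree q \<le> N" shows "shift_act q f k = (\<Sum>i\<le>N. coeff q i * f (k + i))"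
  unfolding shift_act_def using assms
  by (intro sum.mono_neutral_left) (auto simp: coeff_eq_0)

lemma shift_act_0 [simp]: "shift_act 0 f = (\<lambda>k. 0)"
  by (simp add: shift_act_def fun_eq_iff)

lemma shift_act_pCons: "shift_act (pCons a q) f k = a * f k + shift_act q f (Suc k)"
proof -
  have "shift_act (pCons a q) f k = (\<Sum>i\<le>Suc (degree q). coeff (pCons a q) i * f (k + i))"
    by (rule shift_act_bound) (simp add: degree_pCons_le)
  also have "\<dots> = a * f k + (\<Sum>i\<le>degree q. coeff q i * f (Suc k + i))"
    by (subst sum.atMost_Suc_shift) simp
  finally show ?thesis by (simp add: shift_act_def)
qed

lemma shift_act_lin: "shift_act q (\<lambda>k. a * f k + g k) k = a * shift_act q f k + shift_act q g k"
  by (simp add: shift_act_def sum.distrib sum_distrib_left algebra_simps)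

lemma shift_act_add: "shift_act (p + q) f k = shift_act p f k + shift_act q f k"
proof -
  let ?N = "max (degree p) (degree q)"
  have "shift_act (p + q) f k = (\<Sum>i\<le>?N. coeff (p + q) i * f (k + i))"
    by (rule shift_act_bound) (rule degree_add_le_max)
  then show ?thesis
    by (simp add: shift_act_bound[of p ?N] shift_act_bound[of q ?N] sum.distrib algebra_simps)
qed

lemma shift_act_smult: "shift_act (smult a p) f k = a * shift_act p f k"
  by (subst shift_act_bound[where N = "degree p"])
    (simp_all add: degree_smult_le shift_act_def sum_distrib_left mult_ac)

lemma shift_act_mult: "shift_act (p * q) f k = shift_act p (shift_act q f) k"
proof (induction p arbitrary: k)
  case (pCons a p)
  then show ?case
    by (simp add: shift_act_add shift_act_smult shift_act_pCons)
qed simp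

lemma shift_act_sum: "shift_act (\<Sum>i\<in>I. p i) f k = (\<Sum>i\<in>I. shift_act (p i) f k)"
  by (induction I rule: infinite_finite_induct) (auto simp: shift_act_add)

lemma shift_act_sum_right: "shift_act p (\<lambda>k. \<Sum>i\<in>I. f i k) k = (\<Sum>i\<in>I. shift_act p (f i) k)"
  by (simp add: shift_act_def sum_distrib_left) (rule sum.swap)

lemma shift_act_monom: "shift_act (monom a l) f k = a * f (k + l)"
  by (induction l arbitrary: k) (simp_all add: monom_0 monom_Suc shift_act_pCons)

definition poly_matrix :: "(nat \<Rightarrow> 'p::finite cmat) \<Rightarrow> nat \<Rightarrow> complex poly^'p^'p" where
  "poly_matrix M n = (\<chi> i j. \<Sum>l\<le>n. monom (M l $ i $ j) l)"

lemma poly_det_poly_matrix: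
  "poly (det (poly_matrix M n)) z = det (\<Sum>l\<le>n. cscale (z ^ l) (M l))"
proof -
  have "poly (poly_matrix M n $ i $ j) z = (\<Sum>l\<le>n. cscale (z ^ l) (M l)) $ i $ j" for i j
    by (simp add: poly_matrix_def poly_sum poly_monom mult.commute)
  then show ?thesis
    by (simp add: det_def poly_sum poly_prod of_int_poly)
qed

text \<open>Multiplying the system \<open>M(S) x = 0\<close> from the left by the adjugate of
  \<open>M\<close> decouples it: each coordinate of \<open>x\<close> is annihilated by the scalar
  operator \<open>det M (S)\<close>.\<close>

lemma det_poly_matrix_annihilates:
  fixes M :: "nat \<Rightarrow> 'p::finite cmat" and x :: "nat \<Rightarrow> complex^'p"
  assumes "\<And>k. (\<Sum>l\<le>n. M l *v x (k + l)) = 0"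
  shows "shift_act (det (poly_matrix M n)) (\<lambda>i. x i $ j) k = 0"
proof -
  \<comment> \<open>\<open>cofactor_matrix_right\<close> multiplies by the adjugate from the right;
    transposing turns it into the left multiplication required here.\<close>
  define T where "T = transpose (poly_matrix M n)"
  define C where "C = cofactor_matrix T"
  have rel: "(\<Sum>i\<in>UNIV. C$i$j * poly_matrix M n$i$m) = (if m = j then det (poly_matrix M n) else 0)" for j m
  proof -
    have "(T ** C) $ m $ j = (if m = j then det T else 0)"
      unfolding C_def cofactor_matrix_right by simp
    then show ?thesis
      by (simp add: matrix_matrix_mult_def T_def transpose_def mult.commute
          det_transpose[unfolded transpose_def])
  qed
  have row: "(\<Sum>m\<in>UNIV. shift_act (poly_matrix M n$i$m) (\<lambda>k. x k $ m) k) = 0" for i k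
  proof -
    have "(\<Sum>m\<in>UNIV. shift_act (poly_matrix M n$i$m) (\<lambda>k. x k $ m) k)
        = (\<Sum>m\<in>UNIV. \<Sum>l\<le>n. M l $ i $ m * x (k + l) $ m)"
      by (simp add: poly_matrix_def shift_act_sum shift_act_monom)
    also have "\<dots> = (\<Sum>l\<le>n. \<Sum>m\<in>UNIV. M l $ i $ m * x (k + l) $ m)" by (rule sum.swap)
    also have "\<dots> = (\<Sum>l\<le>n. M l *v x (k + l)) $ i"
      by (simp add: matrix_vector_mult_def)
    finally show ?thesis using assms by simp
  qed
  have "shift_act (det (poly_matrix M n)) (\<lambda>i. x i $ j) k
      = (\<Sum>m\<in>UNIV. shift_act (\<Sum>i\<in>UNIV. C$i$j * poly_matrix M n$i$m) (\<lambda>i. x i $ m) k)"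
    unfolding rel by (simp add: if_distrib[of "\<lambda>q. shift_act q f k" for f k] cong: if_cong)
  also have "\<dots> = (\<Sum>i\<in>UNIV. shift_act (C$i$j) (\<lambda>k. \<Sum>m\<in>UNIV. shift_act (poly_matrix M n$i$m) (\<lambda>i. x i $ m) k) k)"
    by (simp add: shift_act_sum shift_act_mult shift_act_sum_right) (rule sum.swap)
  also have "\<dots> = 0"
    unfolding row by (simp add: shift_act_def)
  finally show ?thesis .
qed

context stable_pencil
begin

section \<open>Polynomials in the shift acting on the solution space\<close>

definition vact :: "complex poly \<Rightarrow> (nat \<Rightarrow> complex^'p) \<Rightarrow> nat \<Rightarrow> complex^'p" where
  "vact q x = (\<lambda>k. \<chi> j. shift_act q (\<lambda>i. x i $ j) k)"

lemma vact_pCons: "vact (pCons a q) x = axpy a x (sh (vact q x))"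
  by (simp add: vact_def axpy_def sh_def fun_eq_iff vec_eq_iff shift_act_pCons)

lemma vact_0 [simp]: "vact 0 x = (\<lambda>k. 0)"
  by (simp add: vact_def fun_eq_iff vec_eq_iff)

lemma vact_zero [simp]: "vact q (\<lambda>k. 0) = (\<lambda>k. 0)"
  by (simp add: vact_def fun_eq_iff vec_eq_iff shift_act_def)

lemma vact_axpy: "vact q (axpy a x y) = axpy a (vact q x) (vact q y)"
  by (simp add: vact_def axpy_def fun_eq_iff vec_eq_iff shift_act_lin)

lemma vact_mult: "vact (p * q) x = vact p (vact q x)"
  by (simp add: vact_def fun_eq_iff vec_eq_iff) (simp add: shift_act_mult[abs_def])

lemma vact_linear_mult: "vact ([:- \<mu>, 1:] * r) x = axpy (- \<mu>) (vact r x) (sh (vact r x))"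
  unfolding vact_mult by (simp add: vact_pCons) (simp add: axpy_def sh_def fun_eq_iff)

lemma vact_X: "x \<in> X \<Longrightarrow> vact q x \<in> X"
  by (induction q) (auto simp: X_zero vact_pCons intro!: X_axpy X_sh)

lemma X_unique:
  assumes "x \<in> X" "\<And>k. k < n \<Longrightarrow> x k = 0" shows "x = (\<lambda>k. 0)"
proof
  fix k show "x k = 0"
  proof (induction k rule: less_induct)
    case (less k)
    show ?case
    proof (cases "k < n")
      case False
      then obtain d where d: "k = d + n" using le_Suc_ex[of n k] by (auto simp: add.commute)
      have "(\<Sum>l\<le>n. (P l + Q l) *v x (d + l)) = 0" using assms(1) unfolding X_def by blast
      moreover have "(\<Sum>l<n. (P l + Q l) *v x (d + l)) = 0"
        by (rule sum.neutral) (use less d in auto)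
      ultimately show ?thesis
        by (simp add: lessThan_Suc_atMost[symmetric] P_lead Q_high d)
    qed (simp add: assms)
  qed
qed

lemma X_extend: obtains y where "y \<in> X" "\<And>k. k < n \<Longrightarrow> y k = x k"
proof -
  \<comment> \<open>The companion map on windows of length \<open>n\<close>. Only positions below
    \<open>n\<close> are ever read, and the window of the \<open>k\<close>-th iterate is
    \<open>y k, ..., y (k + n - 1)\<close>.\<close>
  define T where "T = (\<lambda>(y::nat \<Rightarrow> complex^'p) k. if Suc k < n then y (Suc k)
      else - (\<Sum>l<n. (P l + Q l) *v y l))"
  define y where "y k = (T ^^ k) x 0" for k
  have Ty: "(T ^^ k) x j = y (k + j)" if "j < n" for k j
    using that
  proof (induction j arbitrary: k)
    case (Suc j)
    then have "(T ^^ k) x (Suc j) = T ((T ^^ k) x) j" by (simp add: T_def)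
    also have "\<dots> = (T ^^ Suc k) x j" by simp
    also have "\<dots> = y (Suc k + j)" using Suc by (intro Suc.IH) simp
    finally show ?case by simp
  qed (simp add: y_def)
  have "y (k + n) = - (\<Sum>l<n. (P l + Q l) *v y (k + l))" for k
  proof -
    have "y (k + n) = (T ^^ Suc k) x (n - 1)" using Ty[of "n-1" "Suc k"] n_pos by simp
    also have "\<dots> = - (\<Sum>l<n. (P l + Q l) *v (T ^^ k) x l)" using n_pos by (simp add: T_def)
    also have "\<dots> = - (\<Sum>l<n. (P l + Q l) *v y (k + l))" by (simp add: Ty)
    finally show ?thesis .
  qed
  then have "y \<in> X"
    by (simp add: X_def lessThan_Suc_atMost[symmetric] P_lead Q_high)
  moreover have "y k = x k" if "k < n" for k using Ty[of k 0] that by simp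
  ultimately show ?thesis using that by blast
qed

text \<open>For every solution \<open>x\<close> the vector \<open>vact r x\<close> is an eigenvector
  modulo \<open>U\<close> for \<open>\<mu>\<close>, so \<open>good_extend\<close> can absorb it. It
  is enough to absorb the images of the solutions whose initial data are unit vectors, of which
  there are finitely many.\<close>

lemma good_extend_image:
  assumes U: "good U" and sub: "\<And>x. x \<in> X \<Longrightarrow> vact ([:- \<mu>, 1:] * r) x \<in> U" and \<mu>: "Re \<mu> < 0"
  obtains U' where "good U'" "\<And>x. x \<in> X \<Longrightarrow> vact r x \<in> U'"
proof -
  \<comment> \<open>\<open>T\<close> collects the coordinates of the initial data that may be
    nonzero; each induction step frees one coordinate by absorbing the image of its unit
    solution.\<close>
  have "\<exists>U'. good U' \<and> U \<subseteq> U' \<and>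
      (\<forall>x\<in>X. (\<forall>k i. k < n \<longrightarrow> (k, i) \<notin> T \<longrightarrow> x k $ i = 0) \<longrightarrow> vact r x \<in> U')"
    if "finite T" for T :: "(nat \<times> 'p) set"
    using that
  proof induction
    case empty
    have "vact r x \<in> U" if "x \<in> X" "\<forall>k i. k < n \<longrightarrow> x k $ i = 0" for x
      using X_unique[OF that(1)] that(2) goodD(2)[OF U] by (simp add: vec_eq_iff)
    then show ?case using U by auto
  next
    case (insert t T)
    then obtain U1 where U1: "good U1" "U \<subseteq> U1"
      "\<And>x. x \<in> X \<Longrightarrow> (\<And>k i. k < n \<Longrightarrow> (k, i) \<notin> T \<Longrightarrow> x k $ i = 0) \<Longrightarrow> vact r x \<in> U1"
      by blast
    obtain k0 i0 where t: "t = (k0, i0)" by (cases t)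
    obtain e where e: "e \<in> X" "\<And>k. k < n \<Longrightarrow> e k = (if k = k0 then axis i0 1 else 0)"
      using X_extend[of "\<lambda>k. if k = k0 then axis i0 1 else 0"] by blast
    have "axpy (- \<mu>) (vact r e) (sh (vact r e)) \<in> U1"
      using sub[OF e(1)] U1(2) unfolding vact_linear_mult by blast
    then obtain U2 where U2: "good U2" "U1 \<subseteq> U2" "vact r e \<in> U2"
      using good_extend[OF U1(1) vact_X[OF e(1)] _ \<mu>] by blast
    have "vact r x \<in> U2"
      if x: "x \<in> X" "\<forall>k i. k < n \<longrightarrow> (k, i) \<notin> insert t T \<longrightarrow> x k $ i = 0" for x
    proof -
      define a where "a = (if k0 < n then x k0 $ i0 else 0)"
      define y where "y = axpy (- a) e x"
      have "vact r y \<in> U1"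
      proof (rule U1(3))
        show "y \<in> X" unfolding y_def by (intro X_axpy e x)
        fix k i assume "k < n" "(k, i) \<notin> T"
        then show "y k $ i = 0"
          using x(2) by (auto simp: y_def axpy_def e(2) a_def t axis_def)
      qed
      moreover have "x = axpy a e y" by (auto simp: y_def axpy_def)
      ultimately show ?thesis
        using goodD(3)[OF U2(1) U2(3), of "vact r y" a] U2(2) by (auto simp: vact_axpy)
    qed
    then show ?case using U2 U1(2) by (intro exI[of _ U2]) blast
  qed
  from this[of "{..<n} \<times> UNIV"] show ?thesis using that by auto
qed

text \<open>Each linear factor split off \<open>q\<close> is paid for by enlarging \<open>U\<close>;
  once \<open>q\<close> is a nonzero constant, \<open>U\<close> contains all solutions.\<close>

lemma good_exhausts:
  assumes "q \<noteq> 0" "\<And>z. poly q z = 0 \<Longrightarrow> Re z < 0" "good U" "\<And>x. x \<in> X \<Longrightarrow> vact q x \<in> U"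
  shows "\<exists>U'. good U' \<and> X \<subseteq> U'"
  using assms
proof (induction "degree q" arbitrary: q U)
  case 0
  then obtain a where a: "q = [:a:]" "a \<noteq> 0" by (auto elim: degree_eq_zeroE)
  have "x \<in> U" if "x \<in> X" for x
  proof -
    have "axpy (1 / a) (vact q x) (\<lambda>k. 0) \<in> U"
      using 0 that by (intro goodD(3) goodD(2)) auto
    also have "axpy (1 / a) (vact q x) (\<lambda>k. 0) = x"
      using a by (simp add: vact_pCons) (simp add: axpy_def sh_def fun_eq_iff)
    finally show ?thesis .
  qed
  then show ?case using 0 by blast
next
  case (Suc d)
  then have "\<not> constant (poly q)" by (simp add: constant_degree)
  then obtain \<mu> where \<mu>: "poly q \<mu> = 0" using Fundamental_Theorem_Algebra.fundamental_theorem_of_algebra by blast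
  then obtain r where r: "q = [:- \<mu>, 1:] * r" by (auto simp: poly_eq_0_iff_dvd)
  have r0: "r \<noteq> 0" using Suc.prems(1) r by auto
  have "degree q = Suc (degree r)"
    unfolding r using r0 by (subst degree_mult_eq) auto
  then have d: "d = degree r" using Suc.hyps by simp
  obtain U' where U': "good U'" "\<And>x. x \<in> X \<Longrightarrow> vact r x \<in> U'"
    using good_extend_image[of U \<mu> r] Suc.prems \<mu> r by blast
  show ?case
    by (rule Suc.hyps(1)[OF d r0 _ U']) (use Suc.prems(2) r in auto)
qed

theorem form_pos:
  assumes "k < n" "x k \<noteq> 0"
  shows "Re (\<Sum>k<n. \<Sum>l<n. cinner (x k) (B k l *v x l)) > 0"
proof -
  define q where "q = det (poly_matrix (\<lambda>l. P l + Q l) n)"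
  have q_root: "Re z < 0" if "poly q z = 0" for z
  proof -
    have "det (\<Sum>l\<le>n. cscale (z ^ l) (P l + Q l)) = 0"
      using that unfolding q_def poly_det_poly_matrix .
    then obtain v where "v \<noteq> 0" "(\<Sum>l\<le>n. cscale (z ^ l) (P l + Q l)) *v v = 0"
      using det_eq_0_iff_ker by blast
    then show ?thesis
      by (intro stable[of v]) (simp_all add: sum_matrix_vector cscale_mult_vec)
  qed
  \<comment> \<open>The zero polynomial would have the root 0, whose real part is not
    negative.\<close>
  have "q \<noteq> 0" using q_root[of 0] by auto
  moreover have "vact q x \<in> {\<lambda>k. 0}" if "x \<in> X" for x
    using that unfolding vact_def q_def X_def
    by (simp add: fun_eq_iff vec_eq_iff det_poly_matrix_annihilates)
  ultimately obtain U where U: "good U" "X \<subseteq> U"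
    using good_exhausts[OF _ q_root good_zero] by blast
  obtain y where y: "y \<in> X" "\<And>k. k < n \<Longrightarrow> y k = x k" using X_extend by blast
  have "y \<noteq> (\<lambda>k. 0)" using y(2)[OF assms(1)] assms(2) by metis
  then have "Re (V y y) > 0" using goodD(5)[OF U(1)] U(2) y(1) by blast
  moreover have "V y y = (\<Sum>k<n. \<Sum>l<n. cinner (x k) (B k l *v x l))"
    unfolding V_def by (intro sum.cong refl) (simp add: y(2))
  ultimately show ?thesis by simp
qed

end

section \<open>The Bezoutian and its successive Schur complements\<close>

text \<open>Coefficientwise division of \<open>N\<close> by \<open>\<zeta> + cnj \<eta>\<close>: the
  relation \<open>B (k-1) l + B k (l-1) = N k l\<close> is solved for its first term, column by
  column. The relation for row 0 is not built in.\<close>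

fun bez :: "(nat \<Rightarrow> nat \<Rightarrow> 'p::finite cmat) \<Rightarrow> nat \<Rightarrow> nat \<Rightarrow> 'p cmat" where
  "bez N k 0 = N (Suc k) 0"
| "bez N k (Suc l) = N (Suc k) (Suc l) - bez N (Suc k) l"

lemma bez_high:
  assumes "\<And>k l. k > n \<Longrightarrow> N k l = 0" "k \<ge> n" shows "bez N k l = 0"
  using assms(2) by (induction l arbitrary: k) (simp_all add: assms(1))

lemma bez_sum: "bez N k l = (\<Sum>i\<le>l. cscale ((-1)^i) (N (Suc k + i) (l - i)))"
proof (induction l arbitrary: k)
  case (Suc l)
  show ?case
    by (subst sum.atMost_Suc_shift) (simp add: Suc vec_eq_iff sum_negf del: sum.atMost_Suc)
qed simp

text \<open>The alternating sums are the coefficients of \<open>N\<close> restricted to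
  \<open>cnj \<eta> = - \<zeta>\<close>. Their vanishing says that the division leaves no remainder,
  which is exactly the relation for row 0.\<close>

lemma bez_rec:
  assumes "\<And>s. (\<Sum>i\<le>s. cscale ((-1)^i) (N i (s - i))) = 0"
  shows "(if k = 0 then 0 else bez N (k-1) l) + (if l = 0 then 0 else bez N k (l-1)) = N k l"
proof (cases k)
  case k: 0
  show ?thesis
  proof (cases l)
    case 0
    then show ?thesis using assms[of 0] k by simp
  next
    case (Suc m)
    have "0 = N 0 (Suc m) + (\<Sum>i\<le>m. cscale ((-1)^Suc i) (N (Suc i) (m - i)))"
      using assms[of "Suc m"] by (subst (asm) sum.atMost_Suc_shift) simp
    also have "\<dots> = N 0 (Suc m) - bez N 0 m"
      by (simp add: bez_sum vec_eq_iff sum_negf)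
    finally show ?thesis using k Suc by simp
  qed
next
  case (Suc k')
  then show ?thesis by (cases l) auto
qed

text \<open>The quotient is unique: \<open>bez N\<close> and its adjoint solve the same recurrence,
  and a solution \<open>E\<close> of the homogeneous one vanishes column by column.\<close>

lemma bez_hermitian:
  assumes alt: "\<And>s. (\<Sum>i\<le>s. cscale ((-1)^i) (N i (s - i))) = 0" and N: "\<And>k l. cadj (N k l) = N l k"
  shows "cadj (bez N k l) = bez N l k"
proof -
  define E where "E k l = bez N k l - cadj (bez N l k)" for k l
  have E: "(if k = 0 then 0 else E (k-1) l) + (if l = 0 then 0 else E k (l-1)) = 0" for k l
  proof -
    have "cadj ((if l = 0 then 0 else bez N (l-1) k) + (if k = 0 then 0 else bez N l (k-1))) = N k l"
      by (subst bez_rec[OF alt]) (rule N)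
    then have *: "(if k = 0 then 0 else cadj (bez N l (k-1))) + (if l = 0 then 0 else cadj (bez N (l-1) k)) = N k l"
      by (simp only: cadj_simps(3) if_distrib[of cadj] cadj_simps(2)) (simp only: add.commute)
    have "(if k = 0 then 0 else E (k-1) l) + (if l = 0 then 0 else E k (l-1))
      = ((if k = 0 then 0 else bez N (k-1) l) + (if l = 0 then 0 else bez N k (l-1)))
      - ((if k = 0 then 0 else cadj (bez N l (k-1))) + (if l = 0 then 0 else cadj (bez N (l-1) k)))"
      by (simp add: E_def)
    then show ?thesis unfolding * bez_rec[OF alt] by simp
  qed
  have "E k l = 0" for k l
  proof (induction l arbitrary: k)
    case 0
    show ?case using E[of "Suc k" 0] by simp
  next
    case (Suc l)
    show ?case using E[of "Suc k" "Suc l"] Suc by simp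
  qed
  from this[of l k] show ?thesis unfolding E_def by (metis eq_iff_diff_eq_0)
qed

section \<open>Matrix polynomials and the Euclidean chain\<close>

definition mev :: "(nat \<Rightarrow> 'p::finite cmat) \<Rightarrow> nat \<Rightarrow> complex \<Rightarrow> 'p cmat" where
  "mev M N \<zeta> = (\<Sum>k\<le>N. cscale (\<zeta>^k) (M k))"

lemma mev_shift:
  assumes "Q N = 0"
  shows "mev (\<lambda>k. if k = 0 then 0 else C ** Q (k - 1)) N \<zeta> = cscale \<zeta> (C ** mev Q N \<zeta>)"
proof (cases N)
  case 0
  then show ?thesis using assms by (simp add: mev_def)
next
  case (Suc M)
  have "mev (\<lambda>k. if k = 0 then 0 else C ** Q (k - 1)) N \<zeta> = (\<Sum>k\<le>M. cscale (\<zeta> ^ Suc k) (C ** Q k))"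
    unfolding mev_def Suc by (subst sum.atMost_Suc_shift) simp
  also have "\<dots> = (\<Sum>k\<le>N. cscale (\<zeta> ^ Suc k) (C ** Q k))"
    using assms Suc by simp
  finally show ?thesis
    by (simp add: mev_def matrix_mult_sum_right cscale_sum cscale_mult_right mult.commute)
qed

definition chain :: "nat \<Rightarrow> (nat \<Rightarrow> 'p::finite cmat) \<Rightarrow> (nat \<Rightarrow> complex \<Rightarrow> 'p cmat) \<Rightarrow> bool" where
  "chain n c f \<longleftrightarrow> (\<forall>j\<in>{1..n}. \<forall>\<zeta>. f (j-1) \<zeta> = cscale \<zeta> (c j ** f j \<zeta>) + f (Suc j) \<zeta>)
     \<and> f (Suc n) = (\<lambda>\<zeta>. 0)"

definition bform :: "nat \<Rightarrow> (nat \<Rightarrow> nat \<Rightarrow> 'p::finite cmat) \<Rightarrow> (nat \<Rightarrow> complex^'p) \<Rightarrow> complex" where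
  "bform n B x = (\<Sum>k<n. \<Sum>l<n. cinner (x k) (B k l *v x l))"

lemma bform_Suc:
  assumes "\<And>k. B k m = 0" "\<And>k. B m k = 0"
  shows "bform (Suc m) B x = bform m B x"
  by (simp add: bform_def assms cinner_simps)

lemma bform_diff_square:
  "bform n (\<lambda>k l. B k l - cadj (Q k) ** C ** Q l) x =
     bform n B x - cinner (\<Sum>k<n. Q k *v x k) (C *v (\<Sum>l<n. Q l *v x l))"
proof -
  have "cinner (\<Sum>k<n. Q k *v x k) (C *v (\<Sum>l<n. Q l *v x l))
      = (\<Sum>k<n. \<Sum>l<n. cinner (x k) ((cadj (Q k) ** C ** Q l) *v x l))"
    by (simp only: cinner_sum_left matrix_vector_sum)
      (simp only: cinner_sum_right cinner_cadj matrix_vector_mul_assoc matrix_mul_assoc)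
  then show ?thesis
    by (simp add: bform_def matrix_vector_mult_diff_rdistrib cinner_simps sum_subtractf)
qed

text \<open>One division step followed by induction on the degree. Positivity of the form makes the
  corner block of \<open>B\<close> positive definite, hence the division possible and its quotient
  positive definite; the Schur complement of that corner belongs to the pair \<open>Q\<close>,
  \<open>P'\<close>. The bound \<open>N\<close> stays fixed, so that \<open>mev\<close> keeps its
  meaning while degrees drop.\<close>

lemma chain_exists:
  fixes P Q :: "nat \<Rightarrow> 'p::finite cmat"
  assumes "invertible (P n)" "\<And>k. k > n \<Longrightarrow> P k = 0" "\<And>k. k \<ge> n \<Longrightarrow> Q k = 0"
    and "\<And>k. odd (n + k) \<Longrightarrow> P k = 0" "\<And>k. even (n + k) \<Longrightarrow> Q k = 0"
    and "\<And>k l. k \<ge> n \<or> l \<ge> n \<Longrightarrow> B k l = 0" "\<And>k l. cadj (B k l) = B l k"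
    and "\<And>k l. (if k = 0 then 0 else B (k-1) l) + (if l = 0 then 0 else B k (l-1))
                  = cadj (Q k) ** P l + cadj (P k) ** Q l"
    and "\<And>x. \<exists>k<n. x k \<noteq> 0 \<Longrightarrow> Re (bform n B x) > 0"
    and "n \<le> N"
  shows "\<exists>c f. (\<forall>j\<in>{1..n}. posdef (c j)) \<and> chain n c f \<and> f 0 = mev P N \<and> f 1 = mev Q N"
  using assms
proof (induction n arbitrary: P Q B)
  case 0
  show ?case
    by (rule exI[of _ "\<lambda>_. 0"], rule exI[of _ "\<lambda>j. if j = 0 then mev P N else (\<lambda>_. 0)"])
      (simp add: chain_def mev_def 0 fun_eq_iff)
next
  case (Suc m)
  note P_inv = Suc.prems(1) and P_high = Suc.prems(2) and Q_high = Suc.prems(3)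
    and P_par = Suc.prems(4) and Q_par = Suc.prems(5) and B_high = Suc.prems(6)
    and B_herm = Suc.prems(7) and B_rec = Suc.prems(8) and B_pos = Suc.prems(9)
  \<comment> \<open>The relation \<open>B_rec\<close> in column \<open>Suc m\<close>, where every
    other entry of \<open>B\<close> and \<open>Q\<close> is zero.\<close>
  have Bm: "B k m = cadj (Q k) ** P (Suc m)" for k
    using B_rec[of k "Suc m"] by (simp add: B_high Q_high split: if_splits)
  define D where "D = B m m"
  have D: "D = cadj (Q m) ** P (Suc m)" by (simp add: D_def Bm)
  have D_herm: "cadj D = D" by (simp add: D_def B_herm)
  have D_pos: "Re (cinner v (D *v v)) > 0" if "v \<noteq> 0" for v
  proof -
    have "bform (Suc m) B (\<lambda>k. if k = m then v else 0) = cinner v (D *v v)"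
      by (simp add: bform_def D_def cinner_simps)
    then show ?thesis using B_pos[of "\<lambda>k. if k = m then v else 0"] that by auto
  qed
  \<comment> \<open>\<open>D\<close> is Hermitian, so it also equals
    \<open>cadj (P (Suc m)) ** Q m\<close>; a null vector of \<open>Q m\<close> would be one of
    \<open>D\<close>.\<close>
  have "v = 0" if "Q m *v v = 0" for v
  proof -
    have "D *v v = cadj (P (Suc m)) *v (Q m *v v)"
      using D_herm D by (metis cadj_mult cadj_simps(1) matrix_vector_mul_assoc)
    then show ?thesis using D_pos[of v] that by (auto simp: cinner_simps)
  qed
  then have Q_inv: "invertible (Q m)" by (simp add: invertible_iff_ker)
  define R where "R = matrix_inv (Q m)"
  have QR: "Q m ** R = mat 1" "R ** Q m = mat 1"
    using Q_inv by (simp_all add: R_def matrix_inv_left matrix_inv_right)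
  define c1 where "c1 = P (Suc m) ** R"
  have c1Q: "c1 ** Q m = P (Suc m)" by (simp add: c1_def QR flip: matrix_mul_assoc)
  have "cadj R ** cadj (Q m) = mat 1" using QR(1) by (metis cadj_mult cadj_simps(6))
  then have c1_D: "c1 = cadj R ** D ** R"
    by (simp add: c1_def D matrix_mul_assoc)
  have c1: "posdef c1"
    unfolding posdef_iff
  proof (intro conjI allI impI)
    show "cadj c1 = c1" unfolding c1_D by (simp add: cadj_mult D_herm matrix_mul_assoc)
    fix y :: "complex^'p" assume "y \<noteq> 0"
    have "R *v y \<noteq> 0"
      using QR(1) \<open>y \<noteq> 0\<close> by (metis matrix_vector_mul_assoc matrix_vector_mul_lid matrix_vector_mult_0_right)
    moreover have "cinner y (c1 *v y) = cinner (R *v y) (D *v (R *v y))"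
      by (simp add: c1_D cinner_cadj matrix_vector_mul_assoc matrix_mul_assoc)
    ultimately show "Re (cinner y (c1 *v y)) > 0" using D_pos by simp
  qed
  define P' where "P' k = P k - (if k = 0 then 0 else c1 ** Q (k - 1))" for k
  \<comment> \<open>Because \<open>B k m = cadj (Q k) ** P (Suc m)\<close>, the subtracted term is
    \<open>B k m\<close>, the inverse of \<open>D\<close>, and \<open>B m l\<close> multiplied
    together: this is the Schur complement of the corner.\<close>
  define B' where "B' k l = B k l - cadj (Q k) ** c1 ** Q l" for k l
  have c1_herm: "cadj c1 = c1" using c1 by (simp add: posdef_iff)
  have B'_herm: "cadj (B' k l) = B' l k" for k l
    by (simp add: B'_def B_herm cadj_mult c1_herm matrix_mul_assoc)
  have B'_high1: "B' k l = 0" if "l \<ge> m" for k l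
  proof (cases "l = m")
    case True
    then show ?thesis by (simp add: B'_def Bm c1Q flip: matrix_mul_assoc)
  next
    case False
    then show ?thesis using that by (simp add: B'_def B_high Q_high)
  qed
  have B'_high: "B' k l = 0" if "k \<ge> m \<or> l \<ge> m" for k l
    using that B'_high1 B'_herm[of l k] by (metis cadj_simps(2))
  \<comment> \<open>At \<open>Suc m\<close> the leading terms cancel by the choice of
    \<open>c1\<close>; at \<open>m\<close> both terms vanish by parity. The degree thus falls by
    two, as \<open>Q\<close> requires of its remainder.\<close>
  have P'_high: "P' k = 0" if "k \<ge> m" for k
  proof -
    consider "k > Suc m" | "k = Suc m" | "k = m" using \<open>k \<ge> m\<close> by (metis Suc_lessI le_neq_implies_less)
    then show ?thesis
    proof cases
      case 3
      then have "P k = 0" by (intro P_par) simp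
      moreover have "Q (k - 1) = 0" if "k > 0" using that 3 by (intro Q_par) auto
      ultimately show ?thesis by (auto simp: P'_def)
    qed (auto simp: P'_def P_high Q_high c1Q)
  qed
  have B'_rec: "(if k = 0 then 0 else B' (k-1) l) + (if l = 0 then 0 else B' k (l-1))
      = cadj (P' k) ** Q l + cadj (Q k) ** P' l" for k l
  proof -
    have "(if k = 0 then 0 else B' (k-1) l) + (if l = 0 then 0 else B' k (l-1))
      = ((if k = 0 then 0 else B (k-1) l) + (if l = 0 then 0 else B k (l-1)))
        - (if k = 0 then 0 else cadj (Q (k-1)) ** c1 ** Q l) - (if l = 0 then 0 else cadj (Q k) ** c1 ** Q (l-1))"
      by (simp add: B'_def)
    also have "\<dots> = cadj (P' k) ** Q l + cadj (Q k) ** P' l"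
      unfolding B_rec
      by (simp add: P'_def matrix_mult_diff cadj_mult c1_herm matrix_mul_assoc)
    finally show ?thesis .
  qed
  have B'_pos: "Re (bform m B' x) > 0" if nz: "\<exists>k<m. x k \<noteq> 0" for x
  proof -
    \<comment> \<open>The free entry at \<open>m\<close> is chosen to make
      \<open>\<Sum>l. Q l *v y l\<close> zero, so the square subtracted from \<open>B\<close>
      disappears at \<open>y\<close>; \<open>B'\<close> itself does not see that entry.\<close>
    define y where "y = x(m := - (R *v (\<Sum>l<m. Q l *v x l)))"
    have "(\<Sum>l<Suc m. Q l *v y l) = (\<Sum>l<m. Q l *v x l) + Q m *v (- (R *v (\<Sum>l<m. Q l *v x l)))"
      by (simp add: y_def)
    also have "\<dots> = 0"
      by (simp add: matrix_vector_mul_assoc QR vec.neg)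
    finally have "bform (Suc m) B' y = bform (Suc m) B y"
      unfolding B'_def bform_diff_square by (simp add: cinner_simps)
    moreover have "bform (Suc m) B' y = bform m B' y"
      by (rule bform_Suc) (simp_all add: B'_high)
    moreover have "bform m B' y = bform m B' x"
      unfolding bform_def by (intro sum.cong refl) (auto simp: y_def)
    moreover have "Re (bform (Suc m) B y) > 0"
    proof (rule B_pos)
      obtain k where "k < m" "x k \<noteq> 0" using nz by blast
      then show "\<exists>k<Suc m. y k \<noteq> 0" by (intro exI[of _ k]) (simp add: y_def)
    qed
    ultimately show ?thesis by simp
  qed
  have P'_par: "P' k = 0" if "even (m + k)" for k
    using that P_par[of k] Q_par[of "k - 1"] by (cases k) (auto simp: P'_def)
  have "\<exists>c f. (\<forall>j\<in>{1..m}. posdef (c j)) \<and> chain m c f \<and> f 0 = mev Q N \<and> f 1 = mev P' N"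
  proof (rule Suc.IH[of Q P' B'])
    show "Q k = 0" if "k > m" for k using that by (simp add: Q_high)
    show "Q k = 0" if "odd (m + k)" for k using that by (simp add: Q_par)
    show "(if k = 0 then 0 else B' (k-1) l) + (if l = 0 then 0 else B' k (l-1))
      = cadj (P' k) ** Q l + cadj (Q k) ** P' l" for k l by (rule B'_rec)
  qed (use Q_inv P'_high P'_par B'_high B'_herm B'_pos \<open>Suc m \<le> N\<close> in auto)
  then obtain c f where cf: "\<And>j. j \<in> {1..m} \<Longrightarrow> posdef (c j)" "chain m c f" "f 0 = mev Q N" "f 1 = mev P' N"
    by blast
  define c' where "c' j = (if j = 1 then c1 else c (j - 1))" for j
  define f' where "f' j = (if j = 0 then mev P N else f (j - 1))" for j
  have top: "mev P N \<zeta> = cscale \<zeta> (c1 ** mev Q N \<zeta>) + mev P' N \<zeta>" for \<zeta>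
  proof -
    have "mev P' N \<zeta> = mev P N \<zeta> - mev (\<lambda>k. if k = 0 then 0 else c1 ** Q (k - 1)) N \<zeta>"
      unfolding mev_def P'_def cscale_diff sum_subtractf by simp
    then show ?thesis using mev_shift[of Q N c1 \<zeta>] Q_high \<open>Suc m \<le> N\<close> by simp
  qed
  have "chain (Suc m) c' f'"
    unfolding chain_def
  proof (intro conjI ballI allI)
    fix j \<zeta> assume j: "j \<in> {1..Suc m}"
    show "f' (j-1) \<zeta> = cscale \<zeta> (c' j ** f' j \<zeta>) + f' (Suc j) \<zeta>"
    proof (cases "j = 1")
      case True
      then show ?thesis using top cf(3,4) by (simp add: f'_def c'_def)
    next
      case False
      then have "j - 1 \<in> {1..m}" using j by auto
      then have "f (j-1-1) \<zeta> = cscale \<zeta> (c (j-1) ** f (j-1) \<zeta>) + f (Suc (j-1)) \<zeta>"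
        using cf(2) unfolding chain_def by blast
      then show ?thesis using False j by (simp add: f'_def c'_def)
    qed
  next
    show "f' (Suc (Suc m)) = (\<lambda>\<zeta>. 0)" using cf(2) by (simp add: f'_def chain_def)
  qed
  moreover have "posdef (c' j)" if "j \<in> {1..Suc m}" for j
  proof (cases "j = 1")
    case False
    then have "j - 1 \<in> {1..m}" using that by auto
    then show ?thesis using False cf(1) by (simp add: c'_def)
  qed (simp add: c'_def c1)
  moreover have "f' 0 = mev P N" "f' 1 = mev Q N" using cf(3) by (simp_all add: f'_def)
  ultimately show ?case by blast
qed

section \<open>Matrix continued fractions\<close>

text \<open>
  \<open>cf d c j\<close> is the fraction \<open>S\<^sub>j\<close> in the variable \<open>\<zeta>\<close> with last index \<open>j + d\<close>; up to a factor
  \<open>\<zeta>\<close> or \<open>1 / \<zeta>\<close> it is \<open>cfR n zf c j (\<zeta>\<^sup>2)\<close>.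
\<close>

primrec cf :: "nat \<Rightarrow> (nat \<Rightarrow> 'p::finite cmat) \<Rightarrow> nat \<Rightarrow> complex \<Rightarrow> 'p cmat" where
  "cf 0 c j \<zeta> = cscale \<zeta> (c j)"
| "cf (Suc d) c j \<zeta> = cscale \<zeta> (c j) + matrix_inv (cf d c (Suc j) \<zeta>)"

lemma tendsto_inverse_at_infinity: "((\<lambda>z::complex. 1 / z) \<longlongrightarrow> 0) at_infinity"
  by (intro tendsto_divide_0[OF tendsto_const] filterlim_ident)

lemma eventually_nonzero_at_infinity: "eventually (\<lambda>z::complex. z \<noteq> 0) at_infinity"
  unfolding eventually_at_infinity by (intro exI[of _ 1]) auto

lemma matrix_inv_scaled:
  assumes "\<zeta> \<noteq> 0" "invertible (cscale (1 / \<zeta>) M)"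
  shows "invertible M" "matrix_inv M = cscale (1 / \<zeta>) (matrix_inv (cscale (1 / \<zeta>) M))"
proof -
  have M: "M = cscale \<zeta> (cscale (1 / \<zeta>) M)" using assms(1) by simp
  show "invertible M" by (subst M) (rule invertible_cscale[OF assms])
  show "matrix_inv M = cscale (1 / \<zeta>) (matrix_inv (cscale (1 / \<zeta>) M))"
    by (subst M) (rule matrix_inv_cscale[OF assms])
qed

text \<open>With \<open>g = S_(j+1) / \<zeta>\<close>, the quotient \<open>S_j / \<zeta>\<close> is
  \<open>c_j\<close> plus \<open>1 / \<zeta>^2\<close> times the inverse of \<open>g\<close>. The
  inverse stays bounded because \<open>g\<close> tends to an invertible matrix.\<close>

lemma cf_tendsto:
  assumes "\<And>i. i \<in> {j..j+d} \<Longrightarrow> invertible (c i)"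
  shows "((\<lambda>\<zeta>. cscale (1 / \<zeta>) (cf d c j \<zeta>)) \<longlongrightarrow> c j) at_infinity"
  using assms
proof (induction d arbitrary: j)
  case 0
  show ?case
    by (rule Lim_transform_eventually[OF tendsto_const])
      (use eventually_nonzero_at_infinity in eventually_elim, simp)
next
  case (Suc d)
  let ?g = "\<lambda>\<zeta>. cscale (1 / \<zeta>) (cf d c (Suc j) \<zeta>)"
  have lim: "(?g \<longlongrightarrow> c (Suc j)) at_infinity" by (rule Suc.IH) (use Suc.prems in auto)
  have inv: "invertible (c (Suc j))" using Suc.prems by auto
  have "((\<lambda>\<zeta>. c j + cscale (1 / \<zeta> * (1 / \<zeta>)) (matrix_inv (?g \<zeta>))) \<longlongrightarrow>
      c j + cscale (0 * 0) (matrix_inv (c (Suc j)))) at_infinity"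
    by (intro tendsto_intros tendsto_cscale tendsto_inverse_at_infinity tendsto_matrix_inv lim inv)
  moreover have "eventually (\<lambda>\<zeta>. c j + cscale (1 / \<zeta> * (1 / \<zeta>)) (matrix_inv (?g \<zeta>))
      = cscale (1 / \<zeta>) (cf (Suc d) c j \<zeta>)) at_infinity"
    using eventually_nonzero_at_infinity tendsto_matrix_inv(2)[OF lim inv]
    by eventually_elim (simp add: cscale_add matrix_inv_scaled(2))
  ultimately show ?case by (simp add: Lim_transform_eventually)
qed

lemma cf_invertible:
  assumes "\<And>i. i \<in> {j..j+d} \<Longrightarrow> invertible (c i)"
  shows "eventually (\<lambda>\<zeta>. invertible (cf d c j \<zeta>)) at_infinity"
proof -
  have "invertible (c j)" using assms by auto
  then have "eventually (\<lambda>\<zeta>. invertible (cscale (1 / \<zeta>) (cf d c j \<zeta>))) at_infinity"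
    by (rule tendsto_matrix_inv(2)[rotated]) (rule cf_tendsto[OF assms])
  with eventually_nonzero_at_infinity show ?thesis by eventually_elim (rule matrix_inv_scaled)
qed

text \<open>The condition on \<open>zf\<close> covers both parities: it is \<open>odd\<close> for
  even \<open>n\<close> and \<open>even\<close> for odd \<open>n\<close>. Inversion exchanges the
  prefactors \<open>\<zeta>\<close> and \<open>1 / \<zeta>\<close>, which matches the alternation of
  terms with and without the factor \<open>z\<close>.\<close>

lemma cfR_eq_cf:
  assumes zf: "\<And>j. 1 \<le> j \<Longrightarrow> j < n \<Longrightarrow> zf j \<longleftrightarrow> odd (n - j)"
    and c: "\<And>j. j \<in> {1..n} \<Longrightarrow> invertible (c j)" and j: "1 \<le> j" "j + Suc d = n"
  shows "eventually (\<lambda>\<zeta>. cfR n zf c j (\<zeta>\<^sup>2) = cscale (if zf j then \<zeta> else 1 / \<zeta>) (cf (Suc d) c j \<zeta>)) at_infinity"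
  using j
proof (induction d arbitrary: j)
  case 0
  then have n: "n = Suc j" and "zf j" and inv: "invertible (c (Suc j))" using zf[of j] c[of "Suc j"] by auto
  have "cfR n zf c j z = cscale z (c j) + matrix_inv (c (Suc j))" for z
    by (subst cfR.simps) (simp add: n)
  then show ?case
    using \<open>zf j\<close> inv eventually_nonzero_at_infinity
    by (auto elim!: eventually_mono simp: cscale_add matrix_inv_cscale power2_eq_square)
next
  case (Suc d)
  have zfj: "zf j \<longleftrightarrow> \<not> zf (Suc j)" using zf[of j] zf[of "Suc j"] Suc.prems by auto
  have inv: "eventually (\<lambda>\<zeta>. invertible (cf (Suc d) c (Suc j) \<zeta>)) at_infinity"
    by (rule cf_invertible) (use Suc.prems in \<open>auto intro!: c\<close>)
  have IH: "eventually (\<lambda>\<zeta>. cfR n zf c (Suc j) (\<zeta>\<^sup>2) =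
      cscale (if zf (Suc j) then \<zeta> else 1 / \<zeta>) (cf (Suc d) c (Suc j) \<zeta>)) at_infinity"
    by (rule Suc.IH) (use Suc.prems in auto)
  have R: "cfR n zf c j z = (if zf j then cscale z (c j) else c j) + matrix_inv (cfR n zf c (Suc j) z)" for z
    by (subst cfR.simps) (use Suc.prems in simp)
  show ?case
    using eventually_nonzero_at_infinity inv IH
  proof eventually_elim
    case (elim \<zeta>)
    then have "cfR n zf c j (\<zeta>\<^sup>2) = (if zf j then cscale (\<zeta>\<^sup>2) (c j) else c j) +
        cscale (if zf j then \<zeta> else 1 / \<zeta>) (matrix_inv (cf (Suc d) c (Suc j) \<zeta>))"
      unfolding R by (simp add: matrix_inv_cscale zfj)
    then show ?case using elim(1) by (simp add: cscale_add power2_eq_square)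
  qed
qed

lemma chain_cf_step:
  assumes "chain n c f" "j \<in> {1..n}"
  shows "f (j-1) \<zeta> = cscale \<zeta> (c j ** f j \<zeta>) + f (Suc j) \<zeta>"
  using assms unfolding chain_def by blast

lemma chain_imp_cf:
  assumes ch: "chain n c f" and c: "\<And>j. j \<in> {1..n} \<Longrightarrow> invertible (c j)" and j: "1 \<le> j" "j + d = n"
  shows "eventually (\<lambda>\<zeta>. f (j-1) \<zeta> = cf d c j \<zeta> ** f j \<zeta>) at_infinity"
  using j
proof (induction d arbitrary: j)
  case 0
  then have "f (j-1) \<zeta> = cf 0 c j \<zeta> ** f j \<zeta>" for \<zeta>
    using chain_cf_step[OF ch, of j] ch by (simp add: chain_def cscale_mult_left)
  then show ?case by simp
next
  case (Suc d)
  have "eventually (\<lambda>\<zeta>. f (Suc j - 1) \<zeta> = cf d c (Suc j) \<zeta> ** f (Suc j) \<zeta>) at_infinity"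
    by (rule Suc.IH) (use Suc.prems in auto)
  moreover have "eventually (\<lambda>\<zeta>. invertible (cf d c (Suc j) \<zeta>)) at_infinity"
    by (rule cf_invertible) (use Suc.prems in \<open>auto intro!: c\<close>)
  ultimately show ?case
  proof eventually_elim
    case (elim \<zeta>)
    have "matrix_inv (cf d c (Suc j) \<zeta>) ** f j \<zeta> = f (Suc j) \<zeta>"
      using elim by (simp add: matrix_mul_assoc matrix_inv_left)
    then show ?case
      using chain_cf_step[OF ch, of j \<zeta>] Suc.prems
      by (simp add: matrix_add_rdistrib cscale_mult_left)
  qed
qed

section \<open>Entire remainders: from the fraction back to a chain\<close>

definition entire :: "(complex \<Rightarrow> 'p::finite cmat) \<Rightarrow> bool" where
  "entire f \<longleftrightarrow> (\<forall>i j. (\<lambda>z. f z $ i $ j) holomorphic_on UNIV)"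

lemma entire_diff: "entire f \<Longrightarrow> entire g \<Longrightarrow> entire (\<lambda>z. f z - g z)"
  by (auto simp: entire_def intro!: holomorphic_intros)

lemma entire_cscale: "entire f \<Longrightarrow> entire (\<lambda>z. cscale z (C ** f z))"
  by (auto simp: entire_def matrix_matrix_mult_def intro!: holomorphic_intros)

lemma entire_mev: "entire (mev M N)"
  by (auto simp: entire_def mev_def intro!: holomorphic_intros)

lemma entire_tendsto_const:
  assumes "entire f" "(f \<longlongrightarrow> M) at_infinity" shows "f z = M"
proof -
  have "f z $ i $ j = M $ i $ j" for i j
    by (rule Liouville_weak) (use assms in \<open>auto simp: entire_def intro!: tendsto_intros\<close>)
  then show ?thesis by (simp add: vec_eq_iff)
qed

text \<open>The Euclidean algorithm with prescribed quotients and no stopping condition: that the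
  remainder of index \<open>n + 1\<close> vanishes has to be proved.\<close>

fun remainders :: "(nat \<Rightarrow> 'p::finite cmat) \<Rightarrow> (complex \<Rightarrow> 'p cmat) \<Rightarrow> (complex \<Rightarrow> 'p cmat) \<Rightarrow> nat \<Rightarrow> complex \<Rightarrow> 'p cmat" where
  "remainders c f0 f1 0 = f0"
| "remainders c f0 f1 (Suc 0) = f1"
| "remainders c f0 f1 (Suc (Suc j)) =
     (\<lambda>\<zeta>. remainders c f0 f1 j \<zeta> - cscale \<zeta> (c (Suc j) ** remainders c f0 f1 (Suc j) \<zeta>))"

lemma entire_remainders:
  assumes "entire f0" "entire f1" shows "entire (remainders c f0 f1 j)"
  using assms by (induction c f0 f1 j rule: remainders.induct) (auto intro: entire_diff entire_cscale)

lemma remainders_cf: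
  assumes c: "\<And>j. j \<in> {1..n} \<Longrightarrow> invertible (c j)"
    and eq: "eventually (\<lambda>\<zeta>. f0 \<zeta> = cf (n-1) c 1 \<zeta> ** f1 \<zeta>) at_infinity" and j: "1 \<le> j" "j \<le> n"
  shows "eventually (\<lambda>\<zeta>. remainders c f0 f1 (j-1) \<zeta> = cf (n-j) c j \<zeta> ** remainders c f0 f1 j \<zeta>) at_infinity"
  using j
proof (induction j rule: dec_induct)
  case base
  then show ?case using eq by simp
next
  case (step j)
  have d: "n - j = Suc (n - Suc j)" using step by simp
  have "eventually (\<lambda>\<zeta>. invertible (cf (n - Suc j) c (Suc j) \<zeta>)) at_infinity"
    by (rule cf_invertible) (use step in \<open>auto intro!: c\<close>)
  moreover have "eventually (\<lambda>\<zeta>. remainders c f0 f1 (j-1) \<zeta> = cf (n-j) c j \<zeta> ** remainders c f0 f1 j \<zeta>) at_infinity"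
    using step by simp
  ultimately show ?case
  proof eventually_elim
    case (elim \<zeta>)
    obtain i where i: "j = Suc i" using step by (cases j) auto
    have "remainders c f0 f1 (Suc j) \<zeta> = matrix_inv (cf (n - Suc j) c (Suc j) \<zeta>) ** remainders c f0 f1 j \<zeta>"
      using elim(2) unfolding d by (simp add: i matrix_add_rdistrib cscale_mult_left)
    then show ?case using elim(1) by (simp add: matrix_mul_assoc matrix_inv_right)
  qed
qed

text \<open>Near infinity each remainder is the previous one divided by a function asymptotic to
  \<open>\<zeta> c_j\<close>. This lowers the growth by one power and multiplies the leading
  coefficient by an invertible matrix.\<close>

lemma remainders_tendsto:
  fixes c :: "nat \<Rightarrow> 'p::finite cmat"
  assumes c: "\<And>j. j \<in> {1..n} \<Longrightarrow> invertible (c j)"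
    and eq: "eventually (\<lambda>\<zeta>. f0 \<zeta> = cf (n-1) c 1 \<zeta> ** f1 \<zeta>) at_infinity"
    and lead: "((\<lambda>\<zeta>. cscale (1 / \<zeta>^n) (f0 \<zeta>)) \<longlongrightarrow> mat 1) at_infinity" and j: "j \<le> n"
  shows "\<exists>M. invertible M \<and> ((\<lambda>\<zeta>. cscale (1 / \<zeta>^(n-j)) (remainders c f0 f1 j \<zeta>)) \<longlongrightarrow> M) at_infinity"
  using j
proof (induction j)
  case 0
  show ?case using lead by (intro exI[of _ "mat 1"]) (simp add: invertible_mat_1)
next
  case (Suc j)
  then obtain M where M: "invertible M"
    "((\<lambda>\<zeta>. cscale (1 / \<zeta>^(n-j)) (remainders c f0 f1 j \<zeta>)) \<longlongrightarrow> M) at_infinity" by auto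
  let ?S = "cf (n - Suc j) c (Suc j)"
  have inv: "invertible (c (Suc j))" using Suc by (intro c) auto
  have lim: "((\<lambda>\<zeta>. cscale (1 / \<zeta>) (?S \<zeta>)) \<longlongrightarrow> c (Suc j)) at_infinity"
    by (rule cf_tendsto) (use Suc in \<open>auto intro!: c\<close>)
  have rem: "eventually (\<lambda>\<zeta>. remainders c f0 f1 j \<zeta> = ?S \<zeta> ** remainders c f0 f1 (Suc j) \<zeta>) at_infinity"
    using remainders_cf[OF c eq, of "Suc j"] Suc.prems by simp
  have "((\<lambda>\<zeta>. matrix_inv (cscale (1 / \<zeta>) (?S \<zeta>)) ** cscale (1 / \<zeta>^(n-j)) (remainders c f0 f1 j \<zeta>))
      \<longlongrightarrow> matrix_inv (c (Suc j)) ** M) at_infinity"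
    by (intro tendsto_matrix_mult tendsto_matrix_inv lim inv M)
  moreover have "eventually (\<lambda>\<zeta>. matrix_inv (cscale (1 / \<zeta>) (?S \<zeta>)) ** cscale (1 / \<zeta>^(n-j)) (remainders c f0 f1 j \<zeta>)
      = cscale (1 / \<zeta>^(n - Suc j)) (remainders c f0 f1 (Suc j) \<zeta>)) at_infinity"
    using eventually_nonzero_at_infinity tendsto_matrix_inv(2)[OF lim inv] rem
  proof eventually_elim
    case (elim \<zeta>)
    let ?g = "cscale (1 / \<zeta>) (?S \<zeta>)"
    have "remainders c f0 f1 j \<zeta> = cscale \<zeta> (?g ** remainders c f0 f1 (Suc j) \<zeta>)"
      using elim Suc.prems by (simp add: cscale_mult_left)
    then have "matrix_inv ?g ** cscale (1 / \<zeta>^(n-j)) (remainders c f0 f1 j \<zeta>)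
        = cscale (\<zeta> / \<zeta>^(n-j)) (matrix_inv ?g ** ?g ** remainders c f0 f1 (Suc j) \<zeta>)"
      by (simp only: cscale_simps cscale_mult_right matrix_mul_assoc mult_1 times_divide_eq_left)
    also have "\<dots> = cscale (\<zeta> / \<zeta>^(n-j)) (remainders c f0 f1 (Suc j) \<zeta>)"
      using elim(2) by (simp only: matrix_inv_left matrix_mul_lid)
    also have "\<zeta> / \<zeta>^(n-j) = 1 / \<zeta>^(n - Suc j)"
      using elim(1) Suc.prems by (simp add: Suc_diff_Suc[symmetric] Suc_le_eq)
    finally show ?case .
  qed
  moreover have "invertible (matrix_inv (c (Suc j)) ** M)"
    by (intro invertible_mult M matrix_inv_eqI(2)[OF matrix_inv_left] inv)
  ultimately show ?case by (blast intro: Lim_transform_eventually)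
qed

text \<open>Argued by contradiction: for \<open>Re \<zeta> \<ge> 0\<close>, downward induction from
  \<open>y (Suc n) = 0\<close> shows that the real part of \<open>cinner (y (Suc j)) (y j)\<close>
  is nonnegative. For \<open>j = 0\<close> it equals \<open>- |y 1|^2\<close>, since
  \<open>y 0 = - y 1\<close>.\<close>

lemma chain_stable:
  assumes ch: "chain n c f" and c: "\<And>j. j \<in> {1..n} \<Longrightarrow> posdef (c j)"
    and n: "n \<ge> 1" and inv: "invertible (f n \<zeta>)" and v: "v \<noteq> 0" "(f 0 \<zeta> + f 1 \<zeta>) *v v = 0"
  shows "Re \<zeta> < 0"
proof (rule ccontr)
  assume "\<not> Re \<zeta> < 0"
  then have \<zeta>: "Re \<zeta> \<ge> 0" by simp
  define y where "y j = f j \<zeta> *v v" for j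
  have step: "y (j-1) = \<zeta> *s (c j *v y j) + y (Suc j)" if "j \<in> {1..n}" for j
    unfolding y_def chain_cf_step[OF ch that]
    by (simp add: matrix_vector_mult_add_rdistrib cscale_mult_vec matrix_vector_mul_assoc)
  have e: "Re (cinner (y (Suc j)) (y j)) \<ge> 0" if "j \<le> n" for j
    using that
  proof (induction j rule: inc_induct)
    case base
    then show ?case using ch by (simp add: y_def chain_def cinner_simps)
  next
    case (step j)
    have "c (Suc j) *v y (Suc j) = 0 \<or> Re (cinner (y (Suc j)) (c (Suc j) *v y (Suc j))) > 0"
      using c[of "Suc j"] step by (cases "y (Suc j) = 0") (auto simp: posdef_iff)
    moreover have "Im (cinner (y (Suc j)) (c (Suc j) *v y (Suc j))) = 0"
    proof -
      have "cnj (cinner (y (Suc j)) (c (Suc j) *v y (Suc j))) = cinner (y (Suc j)) (c (Suc j) *v y (Suc j))"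
        using c[of "Suc j"] step by (simp add: cnj_cinner cinner_cadj posdef_iff)
      then show ?thesis by (metis Reals_cnj_iff complex_is_Real_iff)
    qed
    ultimately have "Re (\<zeta> * cinner (y (Suc j)) (c (Suc j) *v y (Suc j))) \<ge> 0"
      using \<zeta> by (auto simp: cinner_simps)
    moreover have "cinner (y (Suc j)) (y j) = \<zeta> * cinner (y (Suc j)) (c (Suc j) *v y (Suc j))
        + cinner (y (Suc j)) (y (Suc (Suc j)))"
      using \<open>\<And>j. j \<in> {1..n} \<Longrightarrow> y (j-1) = _\<close>[of "Suc j"] step by (simp add: cinner_simps)
    moreover have "Re (cinner (y (Suc j)) (y (Suc (Suc j)))) = Re (cinner (y (Suc (Suc j))) (y (Suc j)))"
      by (subst cnj_cinner[symmetric]) simp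
    ultimately show ?case using step.IH by simp
  qed
  have "y 0 + y 1 = 0" using v(2) by (simp add: y_def matrix_vector_mult_add_rdistrib)
  then have y0: "y 0 = - y 1" by (simp add: eq_neg_iff_add_eq_0)
  have y1: "y 1 = 0"
    using e[of 0] Re_cinner_self_pos[of "y 1"] by (force simp: y0 cinner_simps)
  \<comment> \<open>Two consecutive zeros propagate along the chain up to \<open>y n\<close>, where
    invertibility of \<open>f n \<zeta>\<close> gives the contradiction.\<close>
  have "y j = 0 \<and> y (Suc j) = 0" if "j \<le> n" for j
    using that
  proof (induction j)
    case (Suc j)
    then show ?case using step[of "Suc j"] by simp
  qed (use y0 y1 in simp)
  then have "f n \<zeta> *v v = 0" by (simp add: y_def)
  then show False using inv v(1) invertible_iff_ker by blast
qed

lemma cf_imp_stable: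
  assumes c: "\<And>j. j \<in> {1..n} \<Longrightarrow> posdef (c j)" and n: "n \<ge> 1"
    and ent: "entire f0" "entire f1"
    and eq: "eventually (\<lambda>\<zeta>. f0 \<zeta> = cf (n-1) c 1 \<zeta> ** f1 \<zeta>) at_infinity"
    and lead: "((\<lambda>\<zeta>. cscale (1 / \<zeta>^n) (f0 \<zeta>)) \<longlongrightarrow> mat 1) at_infinity"
    and v: "v \<noteq> 0" "(f0 \<zeta> + f1 \<zeta>) *v v = 0"
  shows "Re \<zeta> < 0"
proof (rule chain_stable[where f = "remainders c f0 f1"])
  have ci: "\<And>j. j \<in> {1..n} \<Longrightarrow> invertible (c j)" using c posdef_invertible by blast
  obtain M where M: "invertible M" "(remainders c f0 f1 n \<longlongrightarrow> M) at_infinity"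
    using remainders_tendsto[OF ci eq lead, of n] by auto
  have "remainders c f0 f1 n \<zeta> = M" for \<zeta>
    by (rule entire_tendsto_const[OF entire_remainders[OF ent] M(2)])
  then show "invertible (remainders c f0 f1 n \<zeta>)" using M(1) by simp
  obtain m where m: "n = Suc m" using n by (cases n) auto
  \<comment> \<open>The innermost fraction is \<open>\<zeta> c_n\<close> without a tail, so the
    remainder of index \<open>Suc n\<close> is zero near infinity and, being entire,
    everywhere.\<close>
  have "eventually (\<lambda>\<zeta>. remainders c f0 f1 m \<zeta> = cscale \<zeta> (c n ** remainders c f0 f1 n \<zeta>)) at_infinity"
    using remainders_cf[OF ci eq, of n] n by (simp add: m cscale_mult_left)
  then have "eventually (\<lambda>\<zeta>. 0 = remainders c f0 f1 (Suc n) \<zeta>) at_infinity"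
    by eventually_elim (simp add: m)
  then have "(remainders c f0 f1 (Suc n) \<longlongrightarrow> 0) at_infinity"
    by (rule Lim_transform_eventually[OF tendsto_const])
  then have "remainders c f0 f1 (Suc n) \<zeta> = 0" for \<zeta>
    by (rule entire_tendsto_const[OF entire_remainders[OF ent]])
  moreover have "remainders c f0 f1 (j-1) \<zeta> = cscale \<zeta> (c j ** remainders c f0 f1 j \<zeta>) + remainders c f0 f1 (Suc j) \<zeta>"
    if "j \<in> {1..n}" for j \<zeta>
    using that by (cases j) auto
  ultimately show "chain n c (remainders c f0 f1)"
    unfolding chain_def by blast
qed (use assms in auto)

section \<open>Even and odd parts\<close>

text \<open>Once the coefficients below \<open>k\<close> vanish, dividing by \<open>w^k\<close> and
  letting \<open>w\<close> tend to 0 isolates the \<open>k\<close>-th one.\<close>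

lemma powser_eq_zero:
  fixes a :: "nat \<Rightarrow> complex"
  assumes "eventually (\<lambda>w. (\<lambda>k. a k * w^k) sums 0) (at 0)"
  shows "a k = 0"
proof (induction k rule: less_induct)
  case (less k)
  have "eventually (\<lambda>w. (\<lambda>i. a (i + k) * w^i) sums 0) (at 0)"
    using assms eventually_neq_at_within[of 0 0 UNIV]
  proof eventually_elim
    case (elim w)
    then have "(\<lambda>i. a (i + k) * w^(i + k)) sums 0"
      by (subst sums_zero_iff_shift) (simp_all add: less)
    then have "(\<lambda>i. a (i + k) * w^(i + k) / w^k) sums (0 / w^k)" by (rule sums_divide)
    then show ?case using elim(2) by (simp add: power_add)
  qed
  then obtain d where "d > 0" "\<And>w. w \<noteq> 0 \<Longrightarrow> norm w < d \<Longrightarrow> (\<lambda>i. a (i + k) * w^i) sums 0"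
    unfolding eventually_at by auto
  from powser_limit_0_strong[OF this] have "((\<lambda>_::complex. 0) \<longlongrightarrow> a (0 + k)) (at 0)" by simp
  from LIM_const_eq[OF this] show ?case by simp
qed

section \<open>Reindexing of sums\<close>

lemma sum_pairs: "(\<Sum>i<2*M. h i) = (\<Sum>j<M. h (2*j) + h (2*j+1))" for h :: "nat \<Rightarrow> 'a::comm_monoid_add"
  by (induction M) (simp_all add: add.assoc)

lemma sum_even: "(\<Sum>i\<le>n. if even i then g i else 0) = (\<Sum>j\<le>n. if 2*j \<le> n then g (2*j) else 0)"
  and sum_odd: "(\<Sum>i\<le>n. if odd i then g i else 0) = (\<Sum>j\<le>n. if 2*j+1 \<le> n then g (2*j+1) else 0)"
  for g :: "nat \<Rightarrow> 'a::comm_monoid_add"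
proof -
  have ext: "(\<Sum>i\<le>n. h i) = (\<Sum>j\<le>n. (if 2*j \<le> n then h (2*j) else 0) + (if 2*j+1 \<le> n then h (2*j+1) else 0))"
    for h :: "nat \<Rightarrow> 'a"
  proof -
    have "(\<Sum>i\<le>n. h i) = (\<Sum>i<2*Suc n. if i \<le> n then h i else 0)"
      by (rule sum.mono_neutral_cong_left) auto
    then show ?thesis by (simp only: sum_pairs lessThan_Suc_atMost)
  qed
  show "(\<Sum>i\<le>n. if even i then g i else 0) = (\<Sum>j\<le>n. if 2*j \<le> n then g (2*j) else 0)"
    by (subst ext) (intro sum.cong refl, simp)
  show "(\<Sum>i\<le>n. if odd i then g i else 0) = (\<Sum>j\<le>n. if 2*j+1 \<le> n then g (2*j+1) else 0)"
    by (subst ext) (intro sum.cong refl, simp)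
qed

lemma sum_triangle_swap:
  "(\<Sum>a\<le>N. \<Sum>b\<le>N-a. g a b) = (\<Sum>b\<le>N. \<Sum>a\<le>N-b. g a b)" for g :: "nat \<Rightarrow> nat \<Rightarrow> 'a::comm_monoid_add"
proof -
  have 1: "{..N-a} = {b \<in> {..N}. a + b \<le> N}" if "a \<le> N" for a using that by auto
  have 2: "{..N-b} = {a \<in> {..N}. a + b \<le> N}" if "b \<le> N" for b using that by auto
  have "(\<Sum>a\<le>N. \<Sum>b\<le>N-a. g a b) = (\<Sum>a\<le>N. sum (g a) {b \<in> {..N}. a + b \<le> N})"
    by (intro sum.cong refl) (simp add: 1)
  also have "\<dots> = (\<Sum>b\<le>N. \<Sum>a\<in>{a \<in> {..N}. a + b \<le> N}. g a b)"
    by (rule sum.swap_restrict) auto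
  also have "\<dots> = (\<Sum>b\<le>N. \<Sum>a\<le>N-b. g a b)"
    by (intro sum.cong refl) (simp add: 2)
  finally show ?thesis .
qed

lemma sum_rev: "(\<Sum>k\<le>n. g (n - k)) = (\<Sum>k\<le>n. g k)" for g :: "nat \<Rightarrow> 'a::comm_monoid_add"
  by (rule sum.reindex_bij_witness[of _ "\<lambda>k. n - k" "\<lambda>k. n - k"]) auto

text \<open>Reversing two coefficient sequences of length \<open>n + 1\<close> turns coefficient
  \<open>s\<close> of their product into coefficient \<open>2*n-s\<close>.\<close>

lemma sum_convolution_rev:
  fixes F :: "nat \<Rightarrow> nat \<Rightarrow> 'a::comm_monoid_add"
  assumes "\<And>a b. a > n \<or> b > n \<Longrightarrow> F a b = 0"
  shows "(\<Sum>i\<le>s. if i \<le> n \<and> s - i \<le> n then F (n - i) (n - (s - i)) else 0) =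
    (if s \<le> 2*n then \<Sum>a\<le>2*n-s. F a (2*n-s-a) else 0)"
proof (cases "s \<le> 2*n")
  case True
  have "(\<Sum>i\<le>s. if i \<le> n \<and> s - i \<le> n then F (n - i) (n - (s - i)) else 0)
      = (\<Sum>i\<in>{i. i \<le> s \<and> i \<le> n \<and> s - i \<le> n}. F (n - i) (n - (s - i)))"
    by (rule sum.mono_neutral_cong_right) auto
  also have "\<dots> = (\<Sum>a\<in>{a. a \<le> 2*n-s \<and> a \<le> n \<and> 2*n-s-a \<le> n}. F a (2*n-s-a))"
    by (rule sum.reindex_bij_witness[of _ "\<lambda>a. n - a" "\<lambda>i. n - i"])
      (use True in \<open>auto intro!: arg_cong2[of _ _ _ _ F]\<close>)
  also have "\<dots> = (\<Sum>a\<le>2*n-s. F a (2*n-s-a))"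
    by (rule sum.mono_neutral_cong_left) (auto intro!: assms)
  finally show ?thesis using True by simp
next
  case False
  then show ?thesis by (auto intro!: sum.neutral)
qed

text \<open>Values of \<open>A\<close> beyond index \<open>n\<close> are arbitrary; cutting them off
  allows sums over ranges that do not depend on parity.\<close>

definition trunc :: "(nat \<Rightarrow> 'p::finite cmat) \<Rightarrow> nat \<Rightarrow> nat \<Rightarrow> 'p cmat" where
  "trunc A n k = (if k \<le> n then A k else 0)"

definition even_coeffs :: "(nat \<Rightarrow> 'p::finite cmat) \<Rightarrow> nat \<Rightarrow> nat \<Rightarrow> 'p cmat" where
  "even_coeffs A n k = (if even k then trunc A n k else 0)"

definition odd_coeffs :: "(nat \<Rightarrow> 'p::finite cmat) \<Rightarrow> nat \<Rightarrow> nat \<Rightarrow> 'p cmat" where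
  "odd_coeffs A n k = (if odd k then trunc A n k else 0)"

definition rev_coeffs :: "(nat \<Rightarrow> 'p::finite cmat) \<Rightarrow> nat \<Rightarrow> nat \<Rightarrow> 'p cmat" where
  "rev_coeffs M n k = (if k \<le> n then M (n - k) else 0)"

text \<open>Ascending coefficients of \<open>G\<^sub>0\<close> and \<open>G\<^sub>1\<close>.\<close>

abbreviation "Pc A n \<equiv> rev_coeffs (even_coeffs A n) n"
abbreviation "Qc A n \<equiv> rev_coeffs (odd_coeffs A n) n"

lemma mev_rev_coeffs: "mev (rev_coeffs M n) n \<zeta> = (\<Sum>k\<le>n. cscale (\<zeta>^(n-k)) (M k))"
proof -
  have "mev (rev_coeffs M n) n \<zeta> = (\<Sum>k\<le>n. cscale (\<zeta>^(n-(n-k))) (M (n-k)))"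
    unfolding mev_def by (intro sum.cong refl) (simp add: rev_coeffs_def)
  then show ?thesis by (simp only: sum_rev[of "\<lambda>k. cscale (\<zeta>^(n-k)) (M k)"])
qed

lemma mpoly_eq: "mpoly A n \<zeta> = mev (Pc A n) n \<zeta> + mev (Qc A n) n \<zeta>"
  unfolding mev_rev_coeffs mpoly_def sum.distrib[symmetric]
  by (intro sum.cong) (auto simp: even_coeffs_def odd_coeffs_def trunc_def)

text \<open>In the variable \<open>w = 1/\<zeta>\<^sup>2\<close> the coefficients of even index form
  a polynomial with constant term \<open>A 0\<close>, whatever the parity of \<open>n\<close>.
  Expansions at infinity thus become power series at 0.\<close>

lemma mev_Pc:
  assumes "\<zeta> \<noteq> 0"
  shows "mev (Pc A n) n \<zeta> = cscale (\<zeta>^n) (mev (\<lambda>j. trunc A n (2*j)) n (1/\<zeta>\<^sup>2))"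
proof -
  have "mev (Pc A n) n \<zeta> = (\<Sum>k\<le>n. if even k then cscale (\<zeta>^(n-k)) (trunc A n k) else 0)"
    unfolding mev_rev_coeffs by (intro sum.cong) (auto simp: even_coeffs_def)
  also have "\<dots> = (\<Sum>j\<le>n. if 2*j \<le> n then cscale (\<zeta>^(n-2*j)) (trunc A n (2*j)) else 0)"
    by (rule sum_even)
  also have "\<dots> = (\<Sum>j\<le>n. cscale (\<zeta>^n) (cscale ((1/\<zeta>\<^sup>2)^j) (trunc A n (2*j))))"
    using assms by (intro sum.cong refl) (auto simp: trunc_def power_diff power_mult power_divide)
  finally show ?thesis by (simp add: mev_def cscale_sum)
qed

lemma mev_Qc:
  assumes "\<zeta> \<noteq> 0"
  shows "mev (Qc A n) n \<zeta> = cscale (\<zeta>^n / \<zeta>) (mev (\<lambda>j. trunc A n (2*j+1)) n (1/\<zeta>\<^sup>2))"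
proof -
  have "mev (Qc A n) n \<zeta> = (\<Sum>k\<le>n. if odd k then cscale (\<zeta>^(n-k)) (trunc A n k) else 0)"
    unfolding mev_rev_coeffs by (intro sum.cong) (auto simp: odd_coeffs_def)
  also have "\<dots> = (\<Sum>j\<le>n. if 2*j+1 \<le> n then cscale (\<zeta>^(n-(2*j+1))) (trunc A n (2*j+1)) else 0)"
    by (rule sum_odd)
  also have "\<dots> = (\<Sum>j\<le>n. cscale (\<zeta>^n / \<zeta>) (cscale ((1/\<zeta>\<^sup>2)^j) (trunc A n (2*j+1))))"
  proof (intro sum.cong refl)
    fix j
    have "\<zeta>^(n-(2*j+1)) = \<zeta>^n / \<zeta> * (1/\<zeta>\<^sup>2)^j" if "2*j+1 \<le> n"
      using assms that by (subst power_diff) (auto simp: power_mult power_divide)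
    then show "(if 2*j+1 \<le> n then cscale (\<zeta>^(n-(2*j+1))) (trunc A n (2*j+1)) else 0)
      = cscale (\<zeta>^n / \<zeta>) (cscale ((1/\<zeta>\<^sup>2)^j) (trunc A n (2*j+1)))"
      by (auto simp: trunc_def)
  qed
  finally show ?thesis by (simp add: mev_def cscale_sum)
qed

lemma mev_inverse:
  assumes "z \<noteq> 0" "\<And>k. k > m \<Longrightarrow> M k = 0" "m \<le> n"
  shows "cscale (z^m) (mev M n (1/z)) = (\<Sum>k\<le>m. cscale (z^(m-k)) (M k))"
proof -
  have "mev M n (1/z) = (\<Sum>k\<le>m. cscale ((1/z)^k) (M k))"
    unfolding mev_def by (rule sum.mono_neutral_right) (use assms in auto)
  then show ?thesis
    using assms(1) by (auto simp: cscale_sum power_diff power_divide intro!: sum.cong)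
qed

lemma Feven_Fodd_even:
  assumes "z \<noteq> 0" "even n" "n > 0"
  shows "Feven A n z = cscale (z^(n div 2)) (mev (\<lambda>j. trunc A n (2*j)) n (1/z))"
    and "Fodd A n z = cscale (z^(n div 2) / z) (mev (\<lambda>j. trunc A n (2*j+1)) n (1/z))"
proof -
  define m where "m = n div 2"
  have n: "n = 2*m" and m: "m > 0" using assms m_def by auto
  show "Feven A n z = cscale (z^(n div 2)) (mev (\<lambda>j. trunc A n (2*j)) n (1/z))"
    unfolding m_def[symmetric]
    by (subst mev_inverse) (use assms in \<open>auto simp: n trunc_def Feven_def intro!: sum.cong\<close>)
  have idx: "Suc (2 * (k - Suc 0)) = 2 * k - Suc 0" if "Suc 0 \<le> k" for k using that by simp
  have "Fodd A n z = (\<Sum>k=1..m. cscale (z^(m-k)) (A (2*k-1)))"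
    by (simp add: Fodd_def n)
  also have "\<dots> = (\<Sum>k\<le>m-1. cscale (z^(m-1-k)) (trunc A n (2*k+1)))"
    by (rule sum.reindex_bij_witness[of _ Suc "\<lambda>k. k - 1"]) (use m in \<open>auto simp: n trunc_def idx\<close>)
  also have "\<dots> = cscale (z^(m-1)) (mev (\<lambda>j. trunc A n (2*j+1)) n (1/z))"
    by (subst mev_inverse) (use assms in \<open>auto simp: n trunc_def\<close>)
  finally show "Fodd A n z = cscale (z^(n div 2) / z) (mev (\<lambda>j. trunc A n (2*j+1)) n (1/z))"
    using m assms(1) by (simp add: m_def power_diff)
qed

lemma Feven_Fodd_odd:
  assumes "z \<noteq> 0" "odd n"
  shows "Feven A n z = cscale (z^(n div 2)) (mev (\<lambda>j. trunc A n (2*j+1)) n (1/z))"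
    and "Fodd A n z = cscale (z^(n div 2)) (mev (\<lambda>j. trunc A n (2*j)) n (1/z))"
proof -
  obtain m where n: "n = 2*m+1" using assms by (elim oddE)
  show "Feven A n z = cscale (z^(n div 2)) (mev (\<lambda>j. trunc A n (2*j+1)) n (1/z))"
    by (subst mev_inverse) (use assms in \<open>auto simp: n trunc_def Feven_def intro!: sum.cong\<close>)
  show "Fodd A n z = cscale (z^(n div 2)) (mev (\<lambda>j. trunc A n (2*j)) n (1/z))"
    by (subst mev_inverse) (use assms in \<open>auto simp: n trunc_def Fodd_def intro!: sum.cong\<close>)
qed

lemma F_square_even:
  assumes "\<zeta> \<noteq> 0" "even n" "n > 0"
  shows "Feven A n (\<zeta>\<^sup>2) = mev (Pc A n) n \<zeta>" "Fodd A n (\<zeta>\<^sup>2) = cscale (1/\<zeta>) (mev (Qc A n) n \<zeta>)"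
proof -
  have "(\<zeta>\<^sup>2)^(n div 2) = \<zeta>^n" using assms by (simp flip: power_mult)
  then show "Feven A n (\<zeta>\<^sup>2) = mev (Pc A n) n \<zeta>" "Fodd A n (\<zeta>\<^sup>2) = cscale (1/\<zeta>) (mev (Qc A n) n \<zeta>)"
    using assms by (simp_all add: Feven_Fodd_even mev_Pc mev_Qc power2_eq_square)
qed

text \<open>For odd \<open>n\<close> the roles are exchanged: \<open>Fodd\<close> holds the
  coefficients of even index, so it is the one that corresponds to \<open>G\<^sub>0\<close>.\<close>

lemma F_square_odd:
  assumes "\<zeta> \<noteq> 0" "odd n"
  shows "Feven A n (\<zeta>\<^sup>2) = mev (Qc A n) n \<zeta>" "Fodd A n (\<zeta>\<^sup>2) = cscale (1/\<zeta>) (mev (Pc A n) n \<zeta>)"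
proof -
  have "(\<zeta>\<^sup>2)^(n div 2) = \<zeta>^n / \<zeta>"
    using assms by (elim oddE) (simp flip: power_mult)
  then show "Feven A n (\<zeta>\<^sup>2) = mev (Qc A n) n \<zeta>" "Fodd A n (\<zeta>\<^sup>2) = cscale (1/\<zeta>) (mev (Pc A n) n \<zeta>)"
    using assms by (simp_all add: Feven_Fodd_odd mev_Pc mev_Qc)
qed

section \<open>Symmetry from Hermitian Markov parameters\<close>

lemma sums_vec_nth: "f sums (L :: complex^'n^'m) \<Longrightarrow> (\<lambda>k. f k $ i $ j) sums (L $ i $ j)"
  by (intro bounded_linear.sums[OF bounded_linear_vec_nth])

text \<open>With \<open>w = 1/z\<close> both kinds of Markov parameters become the expansion at 0 of
  one quotient; for even \<open>n\<close> the additional factor \<open>1/z\<close> of the series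
  cancels against the lower degree of \<open>Fodd\<close>.\<close>

lemma markov_sums:
  assumes A0: "A 0 = mat 1" and n: "n > 0" and s: "markov_params A n s"
  defines "E \<equiv> mev (\<lambda>j. trunc A n (2*j)) n" and "G \<equiv> mev (\<lambda>j. trunc A n (2*j+1)) n"
  shows "eventually (\<lambda>w. w \<noteq> 0 \<and> invertible (E w) \<and>
      (\<lambda>k. cscale (w^k) (cscale ((-1)^k) (s k))) sums (G w ** matrix_inv (E w))) (at 0)"
proof -
  have "(E \<longlongrightarrow> (\<Sum>k\<le>n. cscale (0^k) (trunc A n (2*k)))) (at 0)"
    unfolding E_def mev_def by (intro tendsto_intros tendsto_cscale)
  also have "(\<Sum>k\<le>n. cscale (0^k) (trunc A n (2*k))) = mat 1"
    by (subst sum.atMost_shift) (simp add: trunc_def A0)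
  finally have E1: "(E \<longlongrightarrow> mat 1) (at 0)" .
  have inv: "eventually (\<lambda>w. invertible (E w)) (at 0)"
    by (rule tendsto_matrix_inv(2)[OF E1 invertible_mat_1])
  obtain r where r: "\<And>z. norm z > r \<Longrightarrow> (if even n then
        (\<lambda>k. cscale ((-1)^k / z^(k+1)) (s k)) sums (Fodd A n z ** matrix_inv (Feven A n z))
      else (\<lambda>k. cscale ((-1)^k / z^k) (s k)) sums (Feven A n z ** matrix_inv (Fodd A n z)))"
    using s unfolding markov_params_def by blast
  have "eventually (\<lambda>w::complex. norm (1 / w) > r) (at 0)"
  proof -
    have "eventually (\<lambda>z::complex. norm z > r) at_infinity"
      unfolding eventually_at_infinity by (intro exI[of _ "r + 1"]) auto
    moreover have "filterlim (\<lambda>w::complex. 1 / w) at_infinity (at 0)"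
      unfolding inverse_eq_divide[symmetric] by (rule filterlim_inverse_at_infinity)
    ultimately show ?thesis by (auto simp: filterlim_iff)
  qed
  from this inv eventually_neq_at_within[of 0 0 UNIV] show ?thesis
  proof eventually_elim
    case (elim w)
    let ?m = "n div 2"
    have z: "1 / w \<noteq> 0" and inv: "invertible (E w)" and w: "w \<noteq> 0" using elim by auto
    have "(\<lambda>k. cscale (w^k) (cscale ((-1)^k) (s k))) sums (G w ** matrix_inv (E w))"
    proof (cases "even n")
      case True
      have "Fodd A n (1/w) ** matrix_inv (Feven A n (1/w)) = cscale w (G w ** matrix_inv (E w))"
        using w inv unfolding Feven_Fodd_even[OF z True n] E_def[symmetric] G_def[symmetric]
        by (simp add: matrix_inv_cscale cscale_mult_left cscale_mult_right power_divide)
      then have "(\<lambda>k. cscale ((-1)^k * w^(k+1)) (s k)) sums cscale w (G w ** matrix_inv (E w))"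
        using r[OF elim(1)] True by (simp add: power_divide)
      then have "(\<lambda>k. cscale (1/w) (cscale ((-1)^k * w^(k+1)) (s k))) sums cscale (1/w) (cscale w (G w ** matrix_inv (E w)))"
        unfolding sums_def cscale_sum[symmetric] by (intro tendsto_cscale tendsto_const)
      then show ?thesis using w by (simp add: mult.commute)
    next
      case False
      have "Feven A n (1/w) ** matrix_inv (Fodd A n (1/w)) = G w ** matrix_inv (E w)"
        using w inv unfolding Feven_Fodd_odd[OF z False] E_def[symmetric] G_def[symmetric]
        by (simp add: matrix_inv_cscale cscale_mult_left cscale_mult_right power_divide)
      then show ?thesis using r[OF elim(1)] False by (simp add: power_divide mult.commute)
    qed
    then show ?case using w inv by simp
  qed
qed

lemma markov_recurrence:
  assumes A0: "A 0 = mat 1" and n: "n > 0" and s: "markov_params A n s"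
  shows "trunc A n (2*k+1) = (\<Sum>j\<le>k. cscale ((-1)^(k-j)) (s (k-j)) ** trunc A n (2*j))"
proof -
  define E where "E = mev (\<lambda>j. trunc A n (2*j)) n"
  define G where "G = mev (\<lambda>j. trunc A n (2*j+1)) n"
  define t where "t k = cscale ((-1)^k) (s k)" for k
  define a where "a k = (\<Sum>j\<le>k. t (k-j) ** trunc A n (2*j))" for k
  \<comment> \<open>The range is made independent of \<open>k\<close>, so that the series times the
    polynomial \<open>E\<close> is a finite sum of shifted series.\<close>
  have a: "a k = (\<Sum>l\<le>n. if l \<le> k then t (k-l) ** trunc A n (2*l) else 0)" for k
  proof -
    have "a k = (\<Sum>l\<le>k+n. if l \<le> k then t (k-l) ** trunc A n (2*l) else 0)"
      unfolding a_def by (rule sum.mono_neutral_cong_left) auto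
    also have "\<dots> = (\<Sum>l\<le>n. if l \<le> k then t (k-l) ** trunc A n (2*l) else 0)"
      by (rule sum.mono_neutral_right) (auto simp: trunc_def)
    finally show ?thesis .
  qed
  have "a k $ i $ j = trunc A n (2*k+1) $ i $ j" for i j
  proof -
    have "eventually (\<lambda>w. (\<lambda>k. (a k $ i $ j - trunc A n (2*k+1) $ i $ j) * w^k) sums 0) (at 0)"
      using markov_sums[OF A0 n s, folded E_def G_def t_def]
    proof eventually_elim
      case (elim w)
      define T where "T = G w ** matrix_inv (E w)"
      have TE: "T ** E w = G w" using elim by (simp add: T_def matrix_inv_left flip: matrix_mul_assoc)
      have ts: "(\<lambda>k. w^k * t k $ i $ m) sums (T $ i $ m)" for m
        using sums_vec_nth[of _ _ i m] elim unfolding T_def by fastforce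
      have "(\<lambda>k. if l \<le> k then w^k * (t (k-l) ** trunc A n (2*l)) $ i $ j else 0)
          sums (w^l * (T ** trunc A n (2*l)) $ i $ j)" for l
      proof (subst sums_zero_iff_shift[of l, symmetric])
        have "(\<lambda>k. w^l * (\<Sum>m\<in>UNIV. w^k * t k $ i $ m * trunc A n (2*l) $ m $ j)) sums
            (w^l * (\<Sum>m\<in>UNIV. T $ i $ m * trunc A n (2*l) $ m $ j))"
          by (intro sums_mult sums_sum sums_mult2 ts)
        then show "(\<lambda>k. if l \<le> k + l then w^(k+l) * (t (k+l-l) ** trunc A n (2*l)) $ i $ j else 0)
            sums (w^l * (T ** trunc A n (2*l)) $ i $ j)"
          by (simp add: matrix_matrix_mult_def sum_distrib_left power_add mult_ac)
      qed auto
      then have "(\<lambda>k. \<Sum>l\<le>n. if l \<le> k then w^k * (t (k-l) ** trunc A n (2*l)) $ i $ j else 0)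
          sums (\<Sum>l\<le>n. w^l * (T ** trunc A n (2*l)) $ i $ j)" by (intro sums_sum)
      moreover have "(\<Sum>l\<le>n. w^l * (T ** trunc A n (2*l)) $ i $ j) = (T ** E w) $ i $ j"
        by (simp add: E_def mev_def matrix_mult_sum_right cscale_mult_right)
      moreover have "(\<Sum>l\<le>n. if l \<le> k then w^k * (t (k-l) ** trunc A n (2*l)) $ i $ j else 0)
          = a k $ i $ j * w^k" for k
        unfolding a by (simp add: sum_distrib_left sum_distrib_right mult.commute if_distrib cong: if_cong)
          (intro sum.cong, auto)
      ultimately have "(\<lambda>k. a k $ i $ j * w^k) sums (G w $ i $ j)" by (simp add: TE)
      moreover have "(\<lambda>k. trunc A n (2*k+1) $ i $ j * w^k) sums (\<Sum>k\<le>n. trunc A n (2*k+1) $ i $ j * w^k)"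
        by (rule sums_finite) (auto simp: trunc_def)
      then have "(\<lambda>k. trunc A n (2*k+1) $ i $ j * w^k) sums (G w $ i $ j)"
        by (simp add: G_def mev_def mult.commute)
      ultimately show ?case
        using sums_diff by (fastforce simp: left_diff_distrib)
    qed
    from powser_eq_zero[OF this] show ?thesis by simp
  qed
  then show ?thesis by (simp add: vec_eq_iff a_def t_def)
qed

text \<open>By \<open>markov_recurrence\<close> the odd part is \<open>G = T E\<close> with
  \<open>T\<close> the Markov series. So \<open>E^* G = E^* T E\<close>, whose coefficients are
  symmetric as long as those of \<open>T\<close> are Hermitian.\<close>

lemma even_odd_convolution_symmetric:
  assumes A0: "A 0 = mat 1" and n: "n > 0" and s: "markov_params A n s" "\<And>k. k < n \<Longrightarrow> hermitian (s k)"
  shows "(\<Sum>a\<le>N. cadj (even_coeffs A n a) ** odd_coeffs A n (N-a))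
       = (\<Sum>a\<le>N. cadj (odd_coeffs A n a) ** even_coeffs A n (N-a))"
proof -
  let ?T = "trunc A n"
  define t where "t k = cscale ((-1)^k) (s k)" for k
  have rec: "?T (2*k+1) = (\<Sum>j\<le>k. t (k-j) ** ?T (2*j))" for k
    unfolding t_def by (rule markov_recurrence[OF A0 n s(1)])
  have t: "cadj (t k) = t k" if "k < n" for k
    using s(2)[OF that] by (simp add: hermitian_iff_cadj t_def cadj_cscale)
  consider M where "N = 2*M" | M where "N = 2*M+1" by (meson evenE oddE)
  then show ?thesis
  proof cases
    case 1
    then have "cadj (even_coeffs A n a) ** odd_coeffs A n (N-a) = 0"
      "cadj (odd_coeffs A n a) ** even_coeffs A n (N-a) = 0" if "a \<le> N" for a
      using that by (auto simp: even_coeffs_def odd_coeffs_def)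
    then show ?thesis by simp
  next
    case N: 2
    have eq1: "(\<Sum>a\<le>N. cadj (even_coeffs A n a) ** odd_coeffs A n (N-a)) = (\<Sum>b\<le>M. cadj (?T (2*b)) ** ?T (2*(M-b)+1))"
    proof -
      have "{..N} = {..<2*Suc M}" by (auto simp: N)
      then have "(\<Sum>a\<le>N. cadj (even_coeffs A n a) ** odd_coeffs A n (N-a))
        = (\<Sum>b<Suc M. cadj (even_coeffs A n (2*b)) ** odd_coeffs A n (N-2*b) + cadj (even_coeffs A n (2*b+1)) ** odd_coeffs A n (N-(2*b+1)))"
        by (simp only: sum_pairs)
      also have "\<dots> = (\<Sum>b\<le>M. cadj (?T (2*b)) ** ?T (2*(M-b)+1))"
        by (rule sum.cong) (auto simp: even_coeffs_def odd_coeffs_def N diff_mult_distrib2 Suc_diff_le)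
      finally show ?thesis .
    qed
    have eq2: "(\<Sum>a\<le>N. cadj (odd_coeffs A n a) ** even_coeffs A n (N-a)) = (\<Sum>b\<le>M. cadj (?T (2*b+1)) ** ?T (2*(M-b)))"
    proof -
      have "{..N} = {..<2*Suc M}" by (auto simp: N)
      then have "(\<Sum>a\<le>N. cadj (odd_coeffs A n a) ** even_coeffs A n (N-a))
        = (\<Sum>b<Suc M. cadj (odd_coeffs A n (2*b)) ** even_coeffs A n (N-2*b) + cadj (odd_coeffs A n (2*b+1)) ** even_coeffs A n (N-(2*b+1)))"
        by (simp only: sum_pairs)
      also have "\<dots> = (\<Sum>b\<le>M. cadj (?T (2*b+1)) ** ?T (2*(M-b)))"
        by (rule sum.cong) (auto simp: even_coeffs_def odd_coeffs_def N diff_mult_distrib2)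
      finally show ?thesis .
    qed
    show ?thesis
    proof (cases "M < n")
      case False
      \<comment> \<open>The two indices add up to \<open>2*M+1 > 2*n\<close>, so one of them exceeds
        \<open>n\<close>. Markov parameters of index \<open>n\<close> and higher are therefore never
        consulted.\<close>
      have "cadj (?T (2*b)) ** ?T (2*(M-b)+1) = 0" "cadj (?T (2*b+1)) ** ?T (2*(M-b)) = 0" if "b \<le> M" for b
        using that False by (auto simp: trunc_def)
      then show ?thesis unfolding eq1 eq2 by simp
    next
      case True
      have "(\<Sum>b\<le>M. cadj (?T (2*b+1)) ** ?T (2*(M-b))) = (\<Sum>b\<le>M. cadj (?T (2*(M-b)+1)) ** ?T (2*b))"
        by (subst sum_rev[symmetric]) (auto intro!: sum.cong)
      also have "\<dots> = (\<Sum>b\<le>M. \<Sum>j\<le>M-b. cadj (?T (2*j)) ** t (M-b-j) ** ?T (2*b))"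
        unfolding rec cadj_sum matrix_mult_sum_left using True by (simp add: cadj_mult t)
      also have "\<dots> = (\<Sum>j\<le>M. \<Sum>b\<le>M-j. cadj (?T (2*j)) ** t (M-b-j) ** ?T (2*b))"
        by (rule sum_triangle_swap)
      also have "\<dots> = (\<Sum>j\<le>M. cadj (?T (2*j)) ** ?T (2*(M-j)+1))"
        unfolding rec matrix_mult_sum_right
        by (intro sum.cong refl) (simp add: matrix_mul_assoc add.commute)
      finally show ?thesis unfolding eq1 eq2 by simp
    qed
  qed
qed

text \<open>This is the divisibility required by \<open>bez_rec\<close>. By parity
  \<open>(-1)^i\<close> is constant on the support of \<open>Pc A n\<close> and has the opposite
  value on that of \<open>Qc A n\<close>; the sum is thus a difference of two convolutions, equal by
  the preceding symmetry read backwards.\<close>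

lemma Pc_Qc_alternating:
  assumes A0: "A 0 = mat 1" and n: "n > 0" and s: "markov_params A n s" "\<And>k. k < n \<Longrightarrow> hermitian (s k)"
  shows "(\<Sum>i\<le>N. cscale ((-1)^i) (cadj (Qc A n i) ** Pc A n (N-i) + cadj (Pc A n i) ** Qc A n (N-i))) = 0"
proof -
  have "(\<Sum>i\<le>N. cscale ((-1)^i) (cadj (Qc A n i) ** Pc A n (N-i) + cadj (Pc A n i) ** Qc A n (N-i)))
      = cscale ((-1)^n) ((\<Sum>i\<le>N. cadj (Pc A n i) ** Qc A n (N-i)) - (\<Sum>i\<le>N. cadj (Qc A n i) ** Pc A n (N-i)))"
    unfolding sum_subtractf[symmetric] cscale_sum
  proof (intro sum.cong refl)
    fix i
    have sg: "Qc A n i = 0 \<and> (-1)^i = ((-1)^n :: complex) \<or> Pc A n i = 0 \<and> (-1)^i = -((-1)^n :: complex)"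
      if "i \<le> n"
    proof (cases "even i \<longleftrightarrow> even n")
      case True
      then show ?thesis using that by (auto simp: rev_coeffs_def odd_coeffs_def minus_one_power_iff)
    next
      case False
      then show ?thesis using that by (auto simp: rev_coeffs_def even_coeffs_def minus_one_power_iff)
    qed
    then show "cscale ((-1)^i) (cadj (Qc A n i) ** Pc A n (N-i) + cadj (Pc A n i) ** Qc A n (N-i))
      = cscale ((-1)^n) (cadj (Pc A n i) ** Qc A n (N-i) - cadj (Qc A n i) ** Pc A n (N-i))"
    proof (cases "i \<le> n")
      case True
      from sg[OF this] show ?thesis by (elim disjE conjE) (simp_all add: cscale_minus_left)
    qed (simp add: rev_coeffs_def)
  qed
  moreover have "(\<Sum>i\<le>N. cadj (Pc A n i) ** Qc A n (N-i)) = (\<Sum>i\<le>N. cadj (Qc A n i) ** Pc A n (N-i))"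
  proof -
    have "(\<Sum>i\<le>N. cadj (Pc A n i) ** Qc A n (N-i)) =
        (\<Sum>i\<le>N. if i \<le> n \<and> N-i \<le> n then cadj (even_coeffs A n (n-i)) ** odd_coeffs A n (n-(N-i)) else 0)"
      by (intro sum.cong) (auto simp: rev_coeffs_def)
    also have "\<dots> = (if N \<le> 2*n then \<Sum>a\<le>2*n-N. cadj (even_coeffs A n a) ** odd_coeffs A n (2*n-N-a) else 0)"
      by (rule sum_convolution_rev) (auto simp: even_coeffs_def odd_coeffs_def trunc_def)
    also have "\<dots> = (if N \<le> 2*n then \<Sum>a\<le>2*n-N. cadj (odd_coeffs A n a) ** even_coeffs A n (2*n-N-a) else 0)"
      by (subst even_odd_convolution_symmetric[OF assms]) auto
    also have "\<dots> = (\<Sum>i\<le>N. if i \<le> n \<and> N-i \<le> n then cadj (odd_coeffs A n (n-i)) ** even_coeffs A n (n-(N-i)) else 0)"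
      by (rule sum_convolution_rev[symmetric]) (auto simp: even_coeffs_def odd_coeffs_def trunc_def)
    also have "\<dots> = (\<Sum>i\<le>N. cadj (Qc A n i) ** Pc A n (N-i))"
      by (intro sum.cong) (auto simp: rev_coeffs_def)
    finally show ?thesis .
  qed
  ultimately show ?thesis by simp
qed

section \<open>The stability criterion\<close>

lemma mev_reflect:
  assumes "\<And>k. odd (d + k) \<Longrightarrow> M k = 0"
  shows "mev M n (- \<zeta>) = cscale ((-1)^d) (mev M n \<zeta>)"
  unfolding mev_def cscale_sum
proof (intro sum.cong refl)
  fix k
  have "M k = 0 \<or> even (d + k)" using assms by auto
  then show "cscale ((- \<zeta>)^k) (M k) = cscale ((-1)^d) (cscale (\<zeta>^k) (M k))"
    by (auto simp: power_minus[of \<zeta> k] minus_one_power_iff)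
qed

lemma mev_leading:
  "((\<lambda>\<zeta>. cscale (1 / \<zeta>^n) (mev M n \<zeta>)) \<longlongrightarrow> M n) at_infinity"
proof -
  have "((\<lambda>\<zeta>. M n + (\<Sum>k<n. cscale ((1 / \<zeta>)^(n-k)) (M k))) \<longlongrightarrow> M n + (\<Sum>k<n. cscale (0^(n-k)) (M k))) at_infinity"
    by (intro tendsto_intros tendsto_cscale tendsto_inverse_at_infinity)
  also have "(\<Sum>k<n. cscale (0^(n-k)) (M k)) = 0" by (simp add: power_0_left)
  finally have "((\<lambda>\<zeta>. M n + (\<Sum>k<n. cscale ((1 / \<zeta>)^(n-k)) (M k))) \<longlongrightarrow> M n) at_infinity" by simp
  moreover have "eventually (\<lambda>\<zeta>. M n + (\<Sum>k<n. cscale ((1 / \<zeta>)^(n-k)) (M k)) = cscale (1 / \<zeta>^n) (mev M n \<zeta>)) at_infinity"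
    using eventually_nonzero_at_infinity
  proof eventually_elim
    case (elim \<zeta>)
    have "cscale (1 / \<zeta>^n) (cscale (\<zeta>^k) (M k)) = cscale ((1 / \<zeta>)^(n-k)) (M k)" if "k \<le> n" for k
      using elim that by (simp add: power_diff power_divide)
    then have "cscale (1 / \<zeta>^n) (mev M n \<zeta>) = (\<Sum>k\<le>n. cscale ((1 / \<zeta>)^(n-k)) (M k))"
      unfolding mev_def cscale_sum by (intro sum.cong) auto
    then show ?case by (simp add: lessThan_Suc_atMost[symmetric] add.commute)
  qed
  ultimately show ?thesis by (rule Lim_transform_eventually)
qed

lemma hurwitz_iff_kernel:
  "hurwitz A n \<longleftrightarrow> (\<forall>\<zeta> v. v \<noteq> 0 \<longrightarrow> (mev (Pc A n) n \<zeta> + mev (Qc A n) n \<zeta>) *v v = 0 \<longrightarrow> Re \<zeta> < 0)"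
  unfolding hurwitz_def det_eq_0_iff_ker mpoly_eq by blast

lemma hurwitz_imp_chain:
  assumes A0: "A 0 = mat 1" and n: "n > 0" and s: "markov_params A n s" "\<And>k. k < n \<Longrightarrow> hermitian (s k)"
    and H: "hurwitz A n"
  shows "\<exists>c f. (\<forall>j\<in>{1..n}. posdef (c j)) \<and> chain n c f \<and> f 0 = mev (Pc A n) n \<and> f 1 = mev (Qc A n) n"
proof -
  define N where "N k l = cadj (Qc A n k) ** Pc A n l + cadj (Pc A n k) ** Qc A n l" for k l
  have alt: "(\<Sum>i\<le>s. cscale ((-1)^i) (N i (s - i))) = 0" for s
    unfolding N_def by (rule Pc_Qc_alternating[OF A0 n s])
  have P_lead: "Pc A n n = mat 1" by (simp add: rev_coeffs_def even_coeffs_def trunc_def A0)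
  have P_high: "Pc A n k = 0" if "k > n" for k using that by (simp add: rev_coeffs_def)
  have Q_high: "Qc A n k = 0" if "k \<ge> n" for k using that by (auto simp: rev_coeffs_def odd_coeffs_def)
  have P_par: "Pc A n k = 0" if "odd (n + k)" for k using that by (auto simp: rev_coeffs_def even_coeffs_def)
  have Q_par: "Qc A n k = 0" if "even (n + k)" for k using that by (auto simp: rev_coeffs_def odd_coeffs_def)
  have N_herm: "cadj (N k l) = N l k" for k l by (simp add: N_def cadj_mult add.commute)
  have herm: "cadj (bez N k l) = bez N l k" for k l by (rule bez_hermitian[OF alt N_herm])
  have high1: "bez N k l = 0" if "k \<ge> n" for k l
    by (rule bez_high[of n]) (use that in \<open>simp_all add: N_def P_high Q_high\<close>)
  have high: "bez N k l = 0" if "k \<ge> n \<or> l \<ge> n" for k l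
    using that high1 herm[of l k] by (metis cadj_simps(2))
  have rec: "(if k = 0 then 0 else bez N (k-1) l) + (if l = 0 then 0 else bez N k (l-1))
      = cadj (Qc A n k) ** Pc A n l + cadj (Pc A n k) ** Qc A n l" for k l
    unfolding bez_rec[OF alt] by (simp add: N_def)
  have stable: "Re \<zeta> < 0" if "v \<noteq> 0" "mev (Pc A n) n \<zeta> *v v + mev (Qc A n) n \<zeta> *v v = 0" for \<zeta> v
    using H that unfolding hurwitz_iff_kernel by (simp add: matrix_vector_mult_add_rdistrib)
  have kernel: "(\<Sum>l\<le>n. \<zeta>^l *s (M l *v v)) = mev M n \<zeta> *v v" for M \<zeta> and v :: "complex^'a"
    by (simp add: mev_def sum_matrix_vector cscale_mult_vec)
  interpret stable_pencil n "Pc A n" "Qc A n" "bez N"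
  proof
    show "Re \<zeta> < 0" if "v \<noteq> 0" "(\<Sum>l\<le>n. \<zeta>^l *s ((Pc A n l + Qc A n l) *v v)) = 0" for \<zeta> v
      using stable[OF that(1), of \<zeta>] that(2)
      by (simp add: matrix_vector_mult_add_rdistrib vector_add_ldistrib sum.distrib kernel)
    show "v = 0" if "(\<Sum>l\<le>n. \<zeta>^l *s (Pc A n l *v v)) = 0" "(\<Sum>l\<le>n. \<zeta>^l *s (Qc A n l *v v)) = 0" for \<zeta> v
    \<comment> \<open>By parity \<open>v\<close> is also a null vector of both parts at
      \<open>-\<zeta>\<close>, and stability would make both real parts negative.\<close>
    proof (rule ccontr)
      assume v: "v \<noteq> 0"
      have PQ: "mev (Pc A n) n \<zeta> *v v = 0" "mev (Qc A n) n \<zeta> *v v = 0" using that by (simp_all add: kernel)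
      have "mev (Pc A n) n (-\<zeta>) = cscale ((-1)^n) (mev (Pc A n) n \<zeta>)"
        "mev (Qc A n) n (-\<zeta>) = cscale ((-1)^Suc n) (mev (Qc A n) n \<zeta>)"
        by (rule mev_reflect, simp add: P_par Q_par)+
      then have "mev (Pc A n) n (-\<zeta>) *v v = 0" "mev (Qc A n) n (-\<zeta>) *v v = 0"
        using PQ by (simp_all add: cscale_mult_vec)
      then have "Re (-\<zeta>) < 0" by (intro stable[OF v]) simp
      moreover have "Re \<zeta> < 0" by (intro stable[OF v]) (simp add: PQ)
      ultimately show False by simp
    qed
  qed (use n P_lead Q_high high herm rec in auto)
  show ?thesis
  proof (rule chain_exists[OF _ P_high Q_high P_par Q_par high herm rec _ order_refl])
    show "invertible (Pc A n n)" unfolding P_lead by (rule invertible_mat_1)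
    fix x :: "nat \<Rightarrow> complex^'a" assume "\<exists>k<n. x k \<noteq> 0"
    then show "Re (bform n (bez N) x) > 0" unfolding bform_def using form_pos by blast
  qed auto
qed

text \<open>The criterion in the variable \<open>\<zeta>\<close>, free of the parity of
  \<open>n\<close>; all parts of the theorem are translations of it.\<close>

lemma hurwitz_iff_cf:
  assumes A0: "A 0 = mat 1" and n: "n > 0" and s: "markov_params A n s" "\<And>k. k < n \<Longrightarrow> hermitian (s k)"
  shows "hurwitz A n \<longleftrightarrow> (\<exists>c. (\<forall>j\<in>{1..n}. posdef (c j)) \<and>
    eventually (\<lambda>\<zeta>. mev (Pc A n) n \<zeta> = cf (n-1) c 1 \<zeta> ** mev (Qc A n) n \<zeta>) at_infinity)"
proof
  assume "hurwitz A n"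
  then obtain c f where c: "\<forall>j\<in>{1..n}. posdef (c j)" and f: "chain n c f" "f 0 = mev (Pc A n) n" "f 1 = mev (Qc A n) n"
    using hurwitz_imp_chain[OF assms] by blast
  have "eventually (\<lambda>\<zeta>. f (1-1) \<zeta> = cf (n-1) c 1 \<zeta> ** f 1 \<zeta>) at_infinity"
    by (rule chain_imp_cf[OF f(1)]) (use c n in \<open>auto intro: posdef_invertible\<close>)
  then show "\<exists>c. (\<forall>j\<in>{1..n}. posdef (c j)) \<and>
    eventually (\<lambda>\<zeta>. mev (Pc A n) n \<zeta> = cf (n-1) c 1 \<zeta> ** mev (Qc A n) n \<zeta>) at_infinity"
    using c f by (intro exI[of _ c]) simp
next
  assume "\<exists>c. (\<forall>j\<in>{1..n}. posdef (c j)) \<and>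
    eventually (\<lambda>\<zeta>. mev (Pc A n) n \<zeta> = cf (n-1) c 1 \<zeta> ** mev (Qc A n) n \<zeta>) at_infinity"
  then obtain c where c: "\<And>j. j \<in> {1..n} \<Longrightarrow> posdef (c j)"
    and eq: "eventually (\<lambda>\<zeta>. mev (Pc A n) n \<zeta> = cf (n-1) c 1 \<zeta> ** mev (Qc A n) n \<zeta>) at_infinity" by blast
  have "((\<lambda>\<zeta>. cscale (1 / \<zeta>^n) (mev (Pc A n) n \<zeta>)) \<longlongrightarrow> mat 1) at_infinity"
    using mev_leading[of n "Pc A n"] by (simp add: rev_coeffs_def even_coeffs_def trunc_def A0)
  from cf_imp_stable[OF c _ entire_mev entire_mev eq this] n show "hurwitz A n"
    unfolding hurwitz_iff_kernel by auto
qed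

section \<open>Translation back to the variable z\<close>

lemma ex_large_iff_eventually:
  "(\<exists>r. \<forall>z::complex. norm z > r \<longrightarrow> \<Phi> z) \<longleftrightarrow> eventually \<Phi> at_infinity"
proof
  assume "\<exists>r. \<forall>z. norm z > r \<longrightarrow> \<Phi> z"
  then obtain r where "\<And>z. norm z > r \<Longrightarrow> \<Phi> z" by blast
  then show "eventually \<Phi> at_infinity"
    unfolding eventually_at_infinity by (intro exI[of _ "r + 1"]) auto
next
  assume "eventually \<Phi> at_infinity"
  then show "\<exists>r. \<forall>z. norm z > r \<longrightarrow> \<Phi> z"
    unfolding eventually_at_infinity by (metis less_imp_le)
qed

text \<open>Squaring maps neighbourhoods of infinity onto neighbourhoods of infinity, since
  \<open>csqrt z\<close> is large together with \<open>z\<close>.\<close>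

lemma eventually_square_iff:
  "eventually \<Phi> at_infinity \<longleftrightarrow> eventually (\<lambda>\<zeta>::complex. \<Phi> (\<zeta>\<^sup>2)) at_infinity"
proof
  assume "eventually \<Phi> at_infinity"
  moreover have "filterlim (\<lambda>\<zeta>::complex. \<zeta>\<^sup>2) at_infinity at_infinity"
    by (intro filterlim_power_at_infinity filterlim_ident) simp
  ultimately show "eventually (\<lambda>\<zeta>. \<Phi> (\<zeta>\<^sup>2)) at_infinity" by (auto simp: filterlim_iff)
next
  assume "eventually (\<lambda>\<zeta>. \<Phi> (\<zeta>\<^sup>2)) at_infinity"
  then obtain r where r: "\<And>\<zeta>. norm \<zeta> \<ge> r \<Longrightarrow> \<Phi> (\<zeta>\<^sup>2)" unfolding eventually_at_infinity by blast
  show "eventually \<Phi> at_infinity"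
    unfolding eventually_at_infinity
  proof (intro exI allI impI)
    fix z :: complex assume "(max r 0)\<^sup>2 \<le> norm z"
    then have "max r 0 \<le> norm (csqrt z)" by (metis real_le_rsqrt norm_csqrt)
    then show "\<Phi> z" using r[of "csqrt z"] by simp
  qed
qed

lemma eventually_cong_at_infinity:
  assumes "eventually (\<lambda>x::complex. P x \<longleftrightarrow> Q x) at_infinity"
  shows "eventually P at_infinity \<longleftrightarrow> eventually Q at_infinity"
  using assms by (rule eventually_subst)

lemma mult_inv_eq_inv_iff:
  fixes M N K :: "'p::finite cmat"
  assumes "invertible M" "invertible N"
  shows "K ** matrix_inv M = matrix_inv N \<longleftrightarrow> M = N ** K"
proof
  assume "K ** matrix_inv M = matrix_inv N"
  then have "N ** (K ** matrix_inv M) ** M = N ** matrix_inv N ** M" by simp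
  then show "M = N ** K"
    using assms by (simp add: matrix_inv_right) (simp add: matrix_inv_left flip: matrix_mul_assoc)
next
  assume "M = N ** K"
  then have "matrix_inv N ** M ** matrix_inv M = matrix_inv N ** (N ** K) ** matrix_inv M" by simp
  then show "K ** matrix_inv M = matrix_inv N"
    using assms by (simp add: matrix_mul_assoc matrix_inv_left) (simp add: matrix_inv_right flip: matrix_mul_assoc)
qed

lemma mult_inv_eq_iff:
  fixes M N K :: "'p::finite cmat"
  assumes "invertible K"
  shows "M ** matrix_inv K = N \<longleftrightarrow> M = N ** K"
  using assms by (metis matrix_inv_left matrix_inv_right matrix_mul_assoc matrix_mul_rid)

lemma eventually_invertible_Pc:
  assumes "A 0 = mat 1"
  shows "eventually (\<lambda>\<zeta>. invertible (mev (Pc A n) n \<zeta>)) at_infinity"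
proof -
  have lim: "((\<lambda>\<zeta>. cscale (1 / \<zeta>^n) (mev (Pc A n) n \<zeta>)) \<longlongrightarrow> mat 1) at_infinity"
    using mev_leading[of n "Pc A n"] by (simp add: rev_coeffs_def even_coeffs_def trunc_def assms)
  from tendsto_matrix_inv(2)[OF lim invertible_mat_1] eventually_nonzero_at_infinity
  show ?thesis
  proof eventually_elim
    case (elim \<zeta>)
    then show ?case using matrix_inv_scaled(1)[of "\<zeta>^n"] by simp
  qed
qed

text \<open>For odd \<open>n\<close> the leading coefficient \<open>A 1\<close> of
  \<open>Feven\<close> may be singular, so invertibility near infinity is drawn from the determinant
  instead: a nonzero polynomial has finitely many roots.\<close>

lemma Feven_regular_eventually:
  assumes "odd n" "\<not> (\<forall>z. det (Feven A n z) = 0)"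
  shows "eventually (\<lambda>z. invertible (Feven A n z)) at_infinity"
proof -
  obtain m where n: "n = 2*m+1" using assms by (elim oddE)
  define q where "q = det (poly_matrix (rev_coeffs (\<lambda>k. A (2*k+1)) m) m)"
  have q: "poly q z = det (Feven A n z)" for z
  proof -
    have "poly q z = det (mev (rev_coeffs (\<lambda>k. A (2*k+1)) m) m z)"
      unfolding q_def poly_det_poly_matrix mev_def ..
    then show ?thesis by (simp add: mev_rev_coeffs Feven_def n atLeast0AtMost)
  qed
  have "q \<noteq> 0" using assms(2) q by (metis poly_0)
  then have "bounded {z. poly q z = 0}" by (intro finite_imp_bounded poly_roots_finite)
  then obtain b where "\<And>z. poly q z = 0 \<Longrightarrow> norm z \<le> b" unfolding bounded_iff by blast
  then have "eventually (\<lambda>z. poly q z \<noteq> 0) at_infinity"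
    unfolding eventually_at_infinity by (intro exI[of _ "b + 1"]) force
  then show ?thesis by (simp add: q invertible_det_nz)
qed

text \<open>At \<open>z = \<zeta>\<^sup>2\<close> both sides carry the factor
  \<open>1/\<zeta>\<close>, which cancels; clearing the two inverses leaves
  \<open>G\<^sub>0 = S\<^sub>1 G\<^sub>1\<close>.\<close>

lemma even_degree_cf_iff:
  assumes "n \<ge> 2" "even n" "A 0 = mat 1" and c: "\<And>j. j \<in> {1..n} \<Longrightarrow> posdef (c j)"
  shows "(\<exists>r. \<forall>z. norm z > r \<longrightarrow> Fodd A n z ** matrix_inv (Feven A n z) = matrix_inv (cfR n odd c 1 z))
    \<longleftrightarrow> eventually (\<lambda>\<zeta>. mev (Pc A n) n \<zeta> = cf (n-1) c 1 \<zeta> ** mev (Qc A n) n \<zeta>) at_infinity"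
proof -
  have ci: "\<And>j. j \<in> {1..n} \<Longrightarrow> invertible (c j)" using c posdef_invertible by blast
  have "eventually (\<lambda>\<zeta>. cfR n odd c 1 (\<zeta>\<^sup>2) = cscale (if odd (1::nat) then \<zeta> else 1 / \<zeta>) (cf (Suc (n - 2)) c 1 \<zeta>)) at_infinity"
    by (rule cfR_eq_cf) (use assms ci in auto)
  then have R: "eventually (\<lambda>\<zeta>. cfR n odd c 1 (\<zeta>\<^sup>2) = cscale \<zeta> (cf (n-1) c 1 \<zeta>)) at_infinity"
    using Suc_diff_Suc[of 1 n] assms(1) by (simp add: numeral_2_eq_2 del: cf.simps)
  have I: "eventually (\<lambda>\<zeta>. invertible (cf (n-1) c 1 \<zeta>)) at_infinity"
    by (rule cf_invertible) (use ci assms(1) in auto)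
  show ?thesis
    unfolding ex_large_iff_eventually
    apply (subst eventually_square_iff)
    apply (rule eventually_cong_at_infinity)
    using R I eventually_invertible_Pc[where A = A and n = n, OF assms(3)] eventually_nonzero_at_infinity
  proof eventually_elim
    case (elim \<zeta>)
    have "(Fodd A n (\<zeta>\<^sup>2) ** matrix_inv (Feven A n (\<zeta>\<^sup>2)) = matrix_inv (cfR n odd c 1 (\<zeta>\<^sup>2)))
      \<longleftrightarrow> cscale (1/\<zeta>) (mev (Qc A n) n \<zeta> ** matrix_inv (mev (Pc A n) n \<zeta>)) = cscale (1/\<zeta>) (matrix_inv (cf (n-1) c 1 \<zeta>))"
      using elim assms by (simp add: F_square_even cscale_mult_left matrix_inv_cscale)
    also have "\<dots> \<longleftrightarrow> mev (Qc A n) n \<zeta> ** matrix_inv (mev (Pc A n) n \<zeta>) = matrix_inv (cf (n-1) c 1 \<zeta>)"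
      using elim(4) by (auto simp: vec_eq_iff)
    finally show ?case using mult_inv_eq_inv_iff[OF elim(3,2)] by simp
  qed
qed

context
  fixes A :: "nat \<Rightarrow> 'p::finite cmat" and n :: nat and c :: "nat \<Rightarrow> 'p cmat"
  assumes n: "n \<ge> 2" "odd n" and A0: "A 0 = mat 1" and c: "\<And>j. j \<in> {1..n} \<Longrightarrow> posdef (c j)"
begin

lemma odd_degree_cfR:
  "eventually (\<lambda>\<zeta>. cfR n even c 1 (\<zeta>\<^sup>2) = cscale (1/\<zeta>) (cf (n-1) c 1 \<zeta>)) at_infinity"
  "eventually (\<lambda>\<zeta>. invertible (cf (n-1) c 1 \<zeta>)) at_infinity"
proof -
  have ci: "\<And>j. j \<in> {1..n} \<Longrightarrow> invertible (c j)" using c posdef_invertible by blast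
  have "eventually (\<lambda>\<zeta>. cfR n even c 1 (\<zeta>\<^sup>2) = cscale (if even (1::nat) then \<zeta> else 1 / \<zeta>) (cf (Suc (n - 2)) c 1 \<zeta>)) at_infinity"
    by (rule cfR_eq_cf) (use n ci in auto)
  then show "eventually (\<lambda>\<zeta>. cfR n even c 1 (\<zeta>\<^sup>2) = cscale (1/\<zeta>) (cf (n-1) c 1 \<zeta>)) at_infinity"
    using Suc_diff_Suc[of 1 n] n(1) by (simp add: numeral_2_eq_2 del: cf.simps)
  show "eventually (\<lambda>\<zeta>. invertible (cf (n-1) c 1 \<zeta>)) at_infinity"
    by (rule cf_invertible) (use ci n(1) in auto)
qed

lemma odd_degree_cf_iff:
  "(\<exists>r. \<forall>z. norm z > r \<longrightarrow> Feven A n z ** matrix_inv (Fodd A n z) = matrix_inv (cfR n even c 1 z))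
    \<longleftrightarrow> eventually (\<lambda>\<zeta>. mev (Pc A n) n \<zeta> = cf (n-1) c 1 \<zeta> ** mev (Qc A n) n \<zeta>) at_infinity"
  unfolding ex_large_iff_eventually
  apply (subst eventually_square_iff)
  apply (rule eventually_cong_at_infinity)
  using odd_degree_cfR eventually_invertible_Pc[where A = A and n = n, OF A0] eventually_nonzero_at_infinity
proof eventually_elim
  case (elim \<zeta>)
  have "(Feven A n (\<zeta>\<^sup>2) ** matrix_inv (Fodd A n (\<zeta>\<^sup>2)) = matrix_inv (cfR n even c 1 (\<zeta>\<^sup>2)))
    \<longleftrightarrow> cscale \<zeta> (mev (Qc A n) n \<zeta> ** matrix_inv (mev (Pc A n) n \<zeta>)) = cscale \<zeta> (matrix_inv (cf (n-1) c 1 \<zeta>))"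
    using elim n by (simp add: F_square_odd cscale_mult_right matrix_inv_cscale)
  also have "\<dots> \<longleftrightarrow> mev (Qc A n) n \<zeta> ** matrix_inv (mev (Pc A n) n \<zeta>) = matrix_inv (cf (n-1) c 1 \<zeta>)"
    using elim(4) by (auto simp: vec_eq_iff)
  finally show ?case using mult_inv_eq_inv_iff[OF elim(3,2)] by simp
qed

text \<open>\<open>matrix_inv\<close> of a singular matrix is an unspecified value, so the equation
  is informative only together with regularity, which makes \<open>Feven\<close> invertible for all
  large \<open>z\<close>. Conversely, \<open>G\<^sub>0 = S\<^sub>1 G\<^sub>1\<close> with
  \<open>G\<^sub>0\<close> invertible near infinity forces \<open>G\<^sub>1\<close> to be invertible
  there, and regularity follows.\<close>

lemma odd_degree_reciprocal_cf_iff: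
  "(\<not> (\<forall>z. det (Feven A n z) = 0)) \<and>
     (\<exists>r. \<forall>z. norm z > r \<longrightarrow> Fodd A n z ** matrix_inv (Feven A n z) = cfR n even c 1 z)
    \<longleftrightarrow> eventually (\<lambda>\<zeta>. mev (Pc A n) n \<zeta> = cf (n-1) c 1 \<zeta> ** mev (Qc A n) n \<zeta>) at_infinity"
  (is "?reg \<and> ?R \<longleftrightarrow> ?E")
proof -
  have iff: "?R \<longleftrightarrow> ?E" if inv: "eventually (\<lambda>\<zeta>. invertible (mev (Qc A n) n \<zeta>)) at_infinity"
    unfolding ex_large_iff_eventually
    apply (subst eventually_square_iff)
    apply (rule eventually_cong_at_infinity)
    using odd_degree_cfR inv eventually_nonzero_at_infinity
  proof eventually_elim
    case (elim \<zeta>)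
    have "(Fodd A n (\<zeta>\<^sup>2) ** matrix_inv (Feven A n (\<zeta>\<^sup>2)) = cfR n even c 1 (\<zeta>\<^sup>2))
      \<longleftrightarrow> cscale (1/\<zeta>) (mev (Pc A n) n \<zeta> ** matrix_inv (mev (Qc A n) n \<zeta>)) = cscale (1/\<zeta>) (cf (n-1) c 1 \<zeta>)"
      using elim n by (simp add: F_square_odd cscale_mult_left)
    also have "\<dots> \<longleftrightarrow> mev (Pc A n) n \<zeta> ** matrix_inv (mev (Qc A n) n \<zeta>) = cf (n-1) c 1 \<zeta>"
      using elim(4) by (auto simp: vec_eq_iff)
    finally show ?case using mult_inv_eq_iff[OF elim(3)] by simp
  qed
  show ?thesis
  proof
    assume R: "?reg \<and> ?R"
    have "eventually (\<lambda>\<zeta>. invertible (Feven A n (\<zeta>\<^sup>2))) at_infinity"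
      using Feven_regular_eventually[OF n(2) conjunct1[OF R]]
      by (subst (asm) eventually_square_iff)
    with eventually_nonzero_at_infinity have "eventually (\<lambda>\<zeta>. invertible (mev (Qc A n) n \<zeta>)) at_infinity"
      by eventually_elim (use n in \<open>simp add: F_square_odd\<close>)
    from iff[OF this] R show ?E by simp
  next
    assume E: ?E
    with eventually_invertible_Pc[where A = A and n = n, OF A0]
    have inv: "eventually (\<lambda>\<zeta>. invertible (mev (Qc A n) n \<zeta>)) at_infinity"
      by eventually_elim (auto simp: invertible_det_nz det_mul)
    have "\<exists>\<zeta>. \<zeta> \<noteq> 0 \<and> invertible (mev (Qc A n) n \<zeta>)"
      using eventually_conj[OF eventually_nonzero_at_infinity inv]
      by (rule eventually_happens'[OF trivial_limit_at_infinity])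
    then obtain \<zeta> where "\<zeta> \<noteq> 0" "invertible (mev (Qc A n) n \<zeta>)" by blast
    then have "det (Feven A n (\<zeta>\<^sup>2)) \<noteq> 0" using n by (simp add: F_square_odd invertible_det_nz)
    then have ?reg by metis
    then show "?reg \<and> ?R" using iff[OF inv] E by simp
  qed
qed

end

theorem theorem4p11:
  fixes A :: "nat \<Rightarrow> complex^'p::finite^'p" and n :: nat and s :: "nat \<Rightarrow> complex^'p^'p"
  assumes "n \<ge> 2"
    and "A 0 = mat 1"
    and "markov_params A n s"
    and "\<forall>k<n. hermitian (s k)"
  shows "(even n \<longrightarrow>
            (hurwitz A n \<longleftrightarrow>
              (\<exists>c. (\<forall>j\<in>{1..n}. posdef (c j)) \<and>
                 (\<exists>r. \<forall>z. norm z > r \<longrightarrow>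
                    Fodd A n z ** matrix_inv (Feven A n z) = matrix_inv (cfR n odd c 1 z)))))
       \<and> (odd n \<longrightarrow>
            (hurwitz A n \<longleftrightarrow>
              (\<exists>c. (\<forall>j\<in>{1..n}. posdef (c j)) \<and>
                 (\<exists>r. \<forall>z. norm z > r \<longrightarrow>
                    Feven A n z ** matrix_inv (Fodd A n z) = matrix_inv (cfR n even c 1 z))))
          \<and> (hurwitz A n \<longleftrightarrow>
              (\<not> (\<forall>z. det (Feven A n z) = 0)) \<and>
              (\<exists>c. (\<forall>j\<in>{1..n}. posdef (c j)) \<and>
                 (\<exists>r. \<forall>z. norm z > r \<longrightarrow>
                    Fodd A n z ** matrix_inv (Feven A n z) = cfR n even c 1 z))))"
proof -
  have H: "hurwitz A n \<longleftrightarrow> (\<exists>c. (\<forall>j\<in>{1..n}. posdef (c j)) \<and>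
    eventually (\<lambda>\<zeta>. mev (Pc A n) n \<zeta> = cf (n-1) c 1 \<zeta> ** mev (Qc A n) n \<zeta>) at_infinity)"
    by (rule hurwitz_iff_cf) (use assms in auto)
  show ?thesis
  proof (intro conjI impI)
    assume "even n"
    then show "hurwitz A n \<longleftrightarrow> (\<exists>c. (\<forall>j\<in>{1..n}. posdef (c j)) \<and>
        (\<exists>r. \<forall>z. norm z > r \<longrightarrow> Fodd A n z ** matrix_inv (Feven A n z) = matrix_inv (cfR n odd c 1 z)))"
      unfolding H using assms by (intro ex_cong1 conj_cong refl even_degree_cf_iff[symmetric]) auto
  next
    assume "odd n"
    then show "hurwitz A n \<longleftrightarrow> (\<exists>c. (\<forall>j\<in>{1..n}. posdef (c j)) \<and>
        (\<exists>r. \<forall>z. norm z > r \<longrightarrow> Feven A n z ** matrix_inv (Fodd A n z) = matrix_inv (cfR n even c 1 z)))"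
      unfolding H using assms by (intro ex_cong1 conj_cong refl odd_degree_cf_iff[symmetric]) auto
  next
    assume "odd n"
    then have "hurwitz A n \<longleftrightarrow> (\<exists>c. (\<forall>j\<in>{1..n}. posdef (c j)) \<and> (\<not> (\<forall>z. det (Feven A n z) = 0)) \<and>
        (\<exists>r. \<forall>z. norm z > r \<longrightarrow> Fodd A n z ** matrix_inv (Feven A n z) = cfR n even c 1 z))"
      unfolding H using assms by (intro ex_cong1 conj_cong refl odd_degree_reciprocal_cf_iff[symmetric]) auto
    then show "hurwitz A n \<longleftrightarrow> (\<not> (\<forall>z. det (Feven A n z) = 0)) \<and>
        (\<exists>c. (\<forall>j\<in>{1..n}. posdef (c j)) \<and>
        (\<exists>r. \<forall>z. norm z > r \<longrightarrow> Fodd A n z ** matrix_inv (Feven A n z) = cfR n even c 1 z))"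
      by blast
  qed
qed

end
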